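(* Let $f=\sum_{\nu\in\mathbb{Z}^d}a_\nu t^\nu\in M_r(\mathbb{Z}[t_1^{\pm1},\dots,t_d^{\pm1}])$ be such that the matrix $f(z)$ is invertible for every $z\in T_p^d$. Then, for the sequence $\Gamma_n=(n\mathbb{Z})^d$ with $n\to\infty$ running through integers prime to $p$, the $p$-adic entropy $h_p(f)=\lim_{n}\frac{1}{n^d}\log_p|\mathrm{Fix}_{\Gamma_n}(X_f)|$ of the $\mathbb{Z}^d$-action on $X_f$ exists and equals $m_p(\det f)=\int_{T_p^d}\log_p(\det f)(z)$ (Snirelman integral).
   Context: $\mathbb{C}_p$ is the completion of an algebraic closure $\overline{\mathbb{Q}}_p$ of $\mathbb{Q}_p$, $T_p^d=\{z\in\mathbb{C}_p^d:|z_i|_p=1\}$, $\log_p:\mathbb{C}_p^*\to\mathbb{C}_p$ the branch of the $p$-adic logarithm with $\log_p(p)=0$. The Snirelman integral of continuous $F:T_p^d\to\mathbb{C}_p$ is $\lim_{N\to\infty,(N,p)=1}N^{-d}\sum_{\zeta\in\mu_N^d}F(\zeta)$, $\mu_N$ the $N$-th roots of unity in $\overline{\mathbb{Q}}_p$. With $\Gamma=\mathbb{Z}^d$ and $T=(\mathbb{R}/\mathbb{Z})^r$, $X_f\subset T^{\Gamma}$ is the closed subgroup of all $(x_{\mu})_{\mu\in\mathbb{Z}^d}$ (row vectors) with $\sum_{\mu}x_{\mu}a^T_{\mu-\lambda}=0$ in $T$ for all $\lambda\in\mathbb{Z}^d$ ($a^T$ transpose), with action $\lambda\cdot(x_\mu)=(x_{\mu-\lambda})$;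 $\mathrm{Fix}_{\Gamma_n}(X_f)$ is the set of points fixed by all of $\Gamma_n$. *)

theory Defs
  imports "HOL-Analysis.Analysis" "HOL-Computational_Algebra.Computational_Algebra"
begin

definition padic_abs_rat :: "nat \<Rightarrow> rat \<Rightarrow> real" where
  "padic_abs_rat p q =
     (if q = 0 then 0
      else (let (a, b) = quotient_of q in
            real p powr (- (real (multiplicity (int p) a) - real (multiplicity (int p) b)))))"

text \<open>A field K with absolute value nv is (isometrically isomorphic to) C_p iff:
  nv is a non-archimedean absolute value restricting to the p-adic absolute value on Q,
  K is complete for nv, algebraically closed, and the algebraic closure of Q_p
  (= elements algebraic over the closure of Q in K) is dense in K.\<close>

definition nv_cauchy :: "('k::field \<Rightarrow> real) \<Rightarrow> (nat \<Rightarrow> 'k) \<Rightarrow> bool" where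
  "nv_cauchy nv X \<longleftrightarrow> (\<forall>e>0. \<exists>N. \<forall>m\<ge>N. \<forall>n\<ge>N. nv (X m - X n) < e)"

definition nv_limit :: "('k::field \<Rightarrow> real) \<Rightarrow> (nat \<Rightarrow> 'k) \<Rightarrow> 'k \<Rightarrow> bool" where
  "nv_limit nv X L \<longleftrightarrow> (\<forall>e>0. \<exists>N. \<forall>n\<ge>N. nv (X n - L) < e)"

definition nv_limit_coprime :: "nat \<Rightarrow> ('k::field \<Rightarrow> real) \<Rightarrow> (nat \<Rightarrow> 'k) \<Rightarrow> 'k \<Rightarrow> bool" where
  "nv_limit_coprime p nv X L \<longleftrightarrow> (\<forall>e>0. \<exists>N. \<forall>n\<ge>N. coprime n p \<longrightarrow> nv (X n - L) < e)"

definition Qp_in :: "('k::field_char_0 \<Rightarrow> real) \<Rightarrow> 'k set" where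
  "Qp_in nv = {x. \<exists>X::nat \<Rightarrow> rat. nv_limit nv (\<lambda>n. of_rat (X n)) x}"

definition alg_Qp_in :: "('k::field_char_0 \<Rightarrow> real) \<Rightarrow> 'k set" where
  "alg_Qp_in nv = {x. \<exists>q::'k poly. q \<noteq> 0 \<and> (\<forall>i. coeff q i \<in> Qp_in nv) \<and> poly q x = 0}"

definition is_Cp :: "nat \<Rightarrow> ('k::field_char_0 \<Rightarrow> real) \<Rightarrow> bool" where
  "is_Cp p nv \<longleftrightarrow>
     prime p \<and>
     (\<forall>x. nv x \<ge> 0) \<and> (\<forall>x. nv x = 0 \<longleftrightarrow> x = 0) \<and>
     (\<forall>x y. nv (x * y) = nv x * nv y) \<and>
     (\<forall>x y. nv (x + y) \<le> max (nv x) (nv y)) \<and>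
     (\<forall>q. nv (of_rat q) = padic_abs_rat p q) \<and>
     (\<forall>X. nv_cauchy nv X \<longrightarrow> (\<exists>L. nv_limit nv X L)) \<and>
     (\<forall>q::'k poly. degree q > 0 \<longrightarrow> (\<exists>x. poly q x = 0)) \<and>
     (\<forall>x. \<forall>e>0. \<exists>y\<in>alg_Qp_in nv. nv (x - y) < e)"

text \<open>The branch of the p-adic logarithm with log_p(p) = 0 (Iwasawa logarithm):
  a homomorphism K^* \<rightarrow> K, given by the usual series on the open unit disc around 1.\<close>

definition is_log_p :: "nat \<Rightarrow> ('k::field_char_0 \<Rightarrow> real) \<Rightarrow> ('k \<Rightarrow> 'k) \<Rightarrow> bool" where
  "is_log_p p nv lg \<longleftrightarrow>
     (\<forall>x y. x \<noteq> 0 \<longrightarrow> y \<noteq> 0 \<longrightarrow> lg (x * y) = lg x + lg y) \<and>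
     lg (of_nat p) = 0 \<and>
     (\<forall>x. nv x < 1 \<longrightarrow>
        nv_limit nv (\<lambda>N. \<Sum>n\<in>{1..N}. (-1) ^ (n + 1) * x ^ n / of_nat n) (lg (1 + x)))"

text \<open>f = sum of a_nu t^nu, coefficients a :: int^'d \<Rightarrow> int^'r^'r finitely supported.\<close>

definition laurent_eval :: "(int^'d \<Rightarrow> int^'r^'r) \<Rightarrow> 'k::field^'d \<Rightarrow> 'k^'r^'r" where
  "laurent_eval a z =
     (\<chi> i j. \<Sum>\<nu>\<in>{\<nu>. a \<nu> \<noteq> 0}. of_int (a \<nu> $ i $ j) * (\<Prod>k\<in>UNIV. (z $ k) powi (\<nu> $ k)))"

definition torus_p :: "('k::field \<Rightarrow> real) \<Rightarrow> ('k^'d::finite) set" where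
  "torus_p nv = {z. \<forall>i. nv (z $ i) = 1}"

definition roots_of_unity :: "nat \<Rightarrow> 'k::field set" where
  "roots_of_unity N = {z. z ^ N = 1}"

definition snirelman_integral_is ::
  "nat \<Rightarrow> ('k::field_char_0 \<Rightarrow> real) \<Rightarrow> ('k^'d::finite \<Rightarrow> 'k) \<Rightarrow> 'k \<Rightarrow> bool" where
  "snirelman_integral_is p nv F I \<longleftrightarrow>
     (\<forall>e>0. \<exists>N0. \<forall>N\<ge>N0. coprime N p \<longrightarrow>
        nv ((1 / of_nat N ^ CARD('d)) *
              (\<Sum>\<zeta>\<in>{\<zeta>::'k^'d. \<forall>i. \<zeta> $ i \<in> roots_of_unity N}. F \<zeta>) - I) < e)"

text \<open>Points of T^\<Gamma>, T = (R/Z)^r, represented by their canonical representatives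
  in [0,1)^r.  Condition: \<Sum>_\<mu> x_\<mu> a^T_{\<mu>-\<lambda>} = 0 in T for all \<lambda>.\<close>

definition X_f :: "(int^'d \<Rightarrow> int^'r^'r) \<Rightarrow> (int^'d \<Rightarrow> real^'r) set" where
  "X_f a = {x. (\<forall>\<mu> j. 0 \<le> x \<mu> $ j \<and> x \<mu> $ j < 1) \<and>
              (\<forall>l j. (\<Sum>\<mu>\<in>{\<mu>. a (\<mu> - l) \<noteq> 0}.
                         \<Sum>i\<in>UNIV. x \<mu> $ i * of_int (transpose (a (\<mu> - l)) $ i $ j)) \<in> \<int>)}"

definition Gamma_n :: "nat \<Rightarrow> (int^'d) set" where
  "Gamma_n n = {l. \<forall>k. int n dvd l $ k}"

definition Fix_Gamma :: "(int^'d) set \<Rightarrow> (int^'d \<Rightarrow> real^'r) set \<Rightarrow> (int^'d \<Rightarrow> real^'r) set" where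
  "Fix_Gamma G X = {x\<in>X. \<forall>l\<in>G. (\<lambda>\<mu>. x (\<mu> - l)) = x}"

end

(*
  The n-periodic points of X_f are the kernel of the toral endomorphism given by the block
  circulant matrix of f on (Z/n)^d. Its order is the absolute value of the determinant, and the
  characters of (Z/n)^d, which take values in C_p, block-diagonalise the matrix, so the determinant
  is the product of det f(zeta) over zeta in mu_n^d. Since log_p kills signs, the n-th term of the
  entropy sequence therefore equals the n-th Snirelman sum of log_p (det f) exactly.

  It remains to see that the Snirelman sums converge. As det f has no zero on the torus T_p^d, one
  of its terms c z^kappa strictly dominates all others: restrict to a one-parameter subgroup that
  separates the exponents, and note that a one-variable polynomial with two coefficients of maximal
  absolute value has a root of absolute value 1. Hence det f = c z^kappa (1 + h) with |h| bounded
  by some delta < 1 on T_p^d. At roots of unity log_p (det f) = log_p c + log_p (1 + h), and the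
  series for log_p (1 + h) converges uniformly on T_p^d. Averaging a Laurent polynomial over mu_N^d
  gives its constant term once N is large, so uniform limits of Laurent polynomials have an
  integral.
*)

theory Submission
  imports "Jordan_Normal_Form.Determinant" Defs
begin

hide_const (open) Determinant.det Matrix.mat Matrix.vec
no_notation fps_nth (infixl "$" 75)
no_notation vec_index (infixl "$" 100)

section \<open>Determinants over finite index sets\<close>

text \<open>The matrices below have size \<open>r n\<^sup>d\<close> with \<open>n\<close> varying, so their index set cannot be a type.\<close>

definition gdet :: "'i set \<Rightarrow> ('i \<Rightarrow> 'i \<Rightarrow> 'a::comm_ring_1) \<Rightarrow> 'a" where
  "gdet I A = (\<Sum>\<pi> | \<pi> permutes I. of_int (sign \<pi>) * (\<Prod>i\<in>I. A i (\<pi> i)))"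

lemma gdet_cong:
  assumes "\<And>i j. i \<in> I \<Longrightarrow> j \<in> I \<Longrightarrow> A i j = B i j"
  shows "gdet I A = gdet I B"
  unfolding gdet_def
  by (intro sum.cong refl arg_cong2[where f="(*)"] prod.cong) (auto simp: assms permutes_in_image)

lemma gdet_empty [simp]: "gdet {} A = 1"
  by (simp add: gdet_def)

lemma gdet_singleton [simp]: "gdet {i} A = A i i"
  by (simp add: gdet_def)

lemma det_eq_gdet: "det A = gdet UNIV (\<lambda>i j. A $ i $ j)"
  by (simp add: det_def gdet_def)

lemma gdet_of_int: "gdet I (\<lambda>i j. of_int (A i j)) = of_int (gdet I A)"
  by (simp add: gdet_def)

text \<open>Conjugation by \<open>h\<close> matches the permutations of \<open>J\<close> with those
  of \<open>I\<close> and preserves signs, so the two Leibniz sums agree term by term.\<close>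

lemma gdet_reindex:
  assumes h: "bij_betw h J I" and fin: "finite J"
  shows "gdet I A = gdet J (\<lambda>i j. A (h i) (h j))"
proof -
  have inj: "inj_on h J" using h by (simp add: bij_betw_def)
  define k where "k = inv_into J h"
  have k: "bij_betw k I J" unfolding k_def using h by (rule bij_betw_inv_into)
  have kh: "k (h x) = x" if "x \<in> J" for x using that inj by (simp add: k_def)
  have hk: "h (k x) = x" if "x \<in> I" for x using that h by (simp add: k_def bij_betw_inv_into_right)
  have "gdet I A = (\<Sum>\<pi> | \<pi> permutes J. of_int (sign (map_permutation J h \<pi>)) * (\<Prod>i\<in>I. A i (map_permutation J h \<pi> i)))"
    unfolding gdet_def
  proof (rule sum.reindex_bij_witness[where i="map_permutation J h" and j="map_permutation I k"])
    fix \<pi> assume "\<pi> \<in> {\<pi>. \<pi> permutes I}"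
    then have p: "\<pi> permutes I" by simp
    show "map_permutation J h (map_permutation I k \<pi>) = \<pi>"
      by (rule map_permutation_compose_inv[OF k p]) (rule hk)
    show "map_permutation I k \<pi> \<in> {\<pi>. \<pi> permutes J}"
      using map_permutation_permutes[OF k p] by simp
    then show "of_int (sign (map_permutation J h (map_permutation I k \<pi>))) * (\<Prod>i\<in>I. A i (map_permutation J h (map_permutation I k \<pi>) i))
       = of_int (sign \<pi>) * (\<Prod>i\<in>I. A i (\<pi> i))"
      by (subst map_permutation_compose_inv[OF k p], auto intro: hk)+
  next
    fix \<pi> assume "\<pi> \<in> {\<pi>. \<pi> permutes J}"
    then have p: "\<pi> permutes J" by simp
    show "map_permutation I k (map_permutation J h \<pi>) = \<pi>"
      by (rule map_permutation_compose_inv[OF h p]) (rule kh)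
    show "map_permutation J h \<pi> \<in> {\<pi>. \<pi> permutes I}"
      using map_permutation_permutes[OF h p] by simp
  qed
  also have "\<dots> = gdet J (\<lambda>i j. A (h i) (h j))"
    unfolding gdet_def
  proof (intro sum.cong refl)
    fix \<pi> assume "\<pi> \<in> {\<pi>. \<pi> permutes J}"
    then have p: "\<pi> permutes J" by simp
    have "(\<Prod>i\<in>I. A i (map_permutation J h \<pi> i)) = (\<Prod>i\<in>J. A (h i) (map_permutation J h \<pi> (h i)))"
      by (rule prod.reindex_bij_betw[OF h, symmetric])
    also have "\<dots> = (\<Prod>i\<in>J. A (h i) (h (\<pi> i)))"
      by (intro prod.cong refl) (simp add: map_permutation_apply[OF inj])
    finally show "of_int (sign (map_permutation J h \<pi>)) * (\<Prod>i\<in>I. A i (map_permutation J h \<pi> i)) =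
       of_int (sign \<pi>) * (\<Prod>i\<in>J. A (h i) (h (\<pi> i)))"
      by (simp add: sign_map_permutation[OF inj p fin])
  qed
  finally show ?thesis .
qed

text \<open>Through an enumeration of \<open>I\<close>, multiplicativity, row operations and block
  formulas carry over from matrices indexed by initial segments of the naturals.\<close>

lemma gdet_eq_det_mat:
  assumes h: "bij_betw h {0..<n} I"
  shows "gdet I A = Determinant.det (Matrix.mat n n (\<lambda>(i, j). A (h i) (h j)))"
proof -
  have "gdet I A = gdet {0..<n} (\<lambda>i j. A (h i) (h j))"
    by (rule gdet_reindex[OF h]) simp
  also have "\<dots> = Determinant.det (Matrix.mat n n (\<lambda>(i, j). A (h i) (h j)))"
    unfolding gdet_def Determinant.det_def
    by (auto intro!: sum.cong prod.cong simp: permutes_in_image)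
  finally show ?thesis .
qed

lemma gdet_mult:
  assumes fin: "finite I"
  shows "gdet I (\<lambda>i j. \<Sum>k\<in>I. A i k * B k j) = gdet I A * gdet I B"
proof -
  obtain h where h: "bij_betw h {0..<card I} I"
    using ex_bij_betw_nat_finite[OF fin] by blast
  have "Matrix.mat (card I) (card I) (\<lambda>(i, j). \<Sum>k\<in>I. A (h i) k * B k (h j)) =
     Matrix.mat (card I) (card I) (\<lambda>(i, j). A (h i) (h j)) * Matrix.mat (card I) (card I) (\<lambda>(i, j). B (h i) (h j))"
    by (intro eq_matI)
       (auto simp: times_mat_def scalar_prod_def sum.reindex_bij_betw[OF h, symmetric])
  then show ?thesis
    by (simp add: gdet_eq_det_mat[OF h] Determinant.det_mult[where n="card I"])
qed

text \<open>With \<open>gdet_swaprows\<close>, one of the two integer row operations that the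
  elimination in \<open>card_box_solutions\<close> performs.\<close>

lemma gdet_addrow:
  assumes fin: "finite I" and i: "i \<in> I" and k: "k \<in> I" and ne: "i \<noteq> k"
  shows "gdet I (A(i := (\<lambda>j. c * A k j + A i j))) = gdet I A"
proof -
  obtain h where h: "bij_betw h {0..<card I} I"
    using ex_bij_betw_nat_finite[OF fin] by blast
  obtain i' k' where i': "i' < card I" "i = h i'" and k': "k' < card I" "k = h k'"
    using h i k unfolding bij_betw_def by (metis atLeastLessThan_iff imageE)
  have eq: "h x = h y \<longleftrightarrow> x = y" if "x < card I" "y < card I" for x y
    using h that by (auto simp: bij_betw_def inj_on_def)
  have "Matrix.mat (card I) (card I) (\<lambda>(x, y). (A(i := (\<lambda>j. c * A k j + A i j))) (h x) (h y))
     = addrow c i' k' (Matrix.mat (card I) (card I) (\<lambda>(i, j). A (h i) (h j)))"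
    using i' k' by (intro eq_matI) (auto simp: mat_addrow_def eq)
  moreover have "i' \<noteq> k'" using ne i' k' by auto
  ultimately show ?thesis
    by (simp add: gdet_eq_det_mat[OF h] det_addrow[where n="card I"] k')
qed

lemma gdet_swaprows:
  assumes fin: "finite I" and i: "i \<in> I" and k: "k \<in> I" and ne: "i \<noteq> k"
  shows "gdet I (A(i := A k, k := A i)) = - gdet I A"
proof -
  obtain h where h: "bij_betw h {0..<card I} I"
    using ex_bij_betw_nat_finite[OF fin] by blast
  obtain i' k' where i': "i' < card I" "i = h i'" and k': "k' < card I" "k = h k'"
    using h i k unfolding bij_betw_def by (metis atLeastLessThan_iff imageE)
  have eq: "h x = h y \<longleftrightarrow> x = y" if "x < card I" "y < card I" for x y
    using h that by (auto simp: bij_betw_def inj_on_def)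
  have "Matrix.mat (card I) (card I) (\<lambda>(x, y). (A(i := A k, k := A i)) (h x) (h y))
     = swaprows i' k' (Matrix.mat (card I) (card I) (\<lambda>(i, j). A (h i) (h j)))"
    using i' k' by (intro eq_matI) (auto simp: mat_swaprows_def eq)
  moreover have "i' \<noteq> k'" using ne i' k' by auto
  ultimately show ?thesis
    by (simp add: gdet_eq_det_mat[OF h] det_swaprows[where n="card I"] k' i')
qed

text \<open>Every permutation of \<open>I\<close> sends some row to column \<open>j\<close>, so
  every Leibniz term has a zero factor.\<close>

lemma gdet_zero_column:
  assumes fin: "finite I" and j: "j \<in> I" and z: "\<And>i. i \<in> I \<Longrightarrow> A i j = 0"
  shows "gdet I A = 0"
  unfolding gdet_def
proof (rule sum.neutral, rule ballI)
  fix \<pi> assume "\<pi> \<in> {\<pi>. \<pi> permutes I}"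
  then have p: "\<pi> permutes I" by simp
  then obtain i where "i \<in> I" "\<pi> i = j" using j by (metis imageE permutes_image)
  then have "(\<Prod>i\<in>I. A i (\<pi> i)) = 0" using fin z by (intro prod_zero) auto
  then show "of_int (sign \<pi>) * (\<Prod>i\<in>I. A i (\<pi> i)) = 0" by simp
qed

text \<open>If \<open>I\<close> is enumerated before \<open>J\<close>, then \<open>A\<close> becomes
  a two-by-two block matrix whose lower left block is zero.\<close>

lemma gdet_block_upper_triangular:
  fixes A :: "'i \<Rightarrow> 'i \<Rightarrow> 'a::idom"
  assumes fin: "finite I" "finite J" and disj: "I \<inter> J = {}"
    and z: "\<And>i j. i \<in> J \<Longrightarrow> j \<in> I \<Longrightarrow> A i j = 0"
  shows "gdet (I \<union> J) A = gdet I A * gdet J A"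
proof -
  define n m where "n = card I" and "m = card J"
  obtain f where f: "bij_betw f {0..<n} I"
    using ex_bij_betw_nat_finite[OF fin(1)] n_def by blast
  obtain g where g: "bij_betw g {0..<m} J"
    using ex_bij_betw_nat_finite[OF fin(2)] m_def by blast
  define h where "h = (\<lambda>k. if k < n then f k else g (k - n))"
  have 1: "bij_betw h {0..<n} I"
    using f by (rule bij_betw_cong[THEN iffD1, rotated]) (simp add: h_def)
  have "bij_betw (\<lambda>k. k - n) {n..<n+m} {0..<m}"
    by (rule bij_betw_byWitness[where f'="\<lambda>k. k + n"]) auto
  then have "bij_betw (g \<circ> (\<lambda>k. k - n)) {n..<n+m} J" using g by (rule bij_betw_trans)
  then have 2: "bij_betw h {n..<n+m} J"
    by (rule bij_betw_cong[THEN iffD1, rotated]) (simp add: h_def)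
  have "bij_betw h ({0..<n} \<union> {n..<n+m}) (I \<union> J)"
    by (rule bij_betw_combine[OF 1 2 disj])
  then have h: "bij_betw h {0..<n+m} (I \<union> J)" by (simp add: ivl_disj_un)
  have mem: "f k \<in> I" if "k < n" for k using f that by (auto simp: bij_betw_def)
  have mem': "g k \<in> J" if "k < m" for k using g that by (auto simp: bij_betw_def)
  have "Matrix.mat (n+m) (n+m) (\<lambda>(i, j). A (h i) (h j)) =
    four_block_mat (Matrix.mat n n (\<lambda>(i, j). A (f i) (f j))) (Matrix.mat n m (\<lambda>(i, j). A (f i) (g j)))
       (0\<^sub>m m n) (Matrix.mat m m (\<lambda>(i, j). A (g i) (g j)))"
    by (intro eq_matI) (auto simp: h_def intro!: z mem mem')
  then show ?thesis
    by (simp add: gdet_eq_det_mat[OF h] gdet_eq_det_mat[OF f] gdet_eq_det_mat[OF g]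
       det_four_block_mat_lower_left_zero[where n=n and m=m])
qed

lemma gdet_block_diagonal:
  fixes B :: "'z \<Rightarrow> 'i \<Rightarrow> 'i \<Rightarrow> 'a::idom"
  assumes "finite Z" and fin: "finite J"
  shows "gdet (Z \<times> J) (\<lambda>(z, i) (z', j). if z = z' then B z i j else 0) = (\<Prod>z\<in>Z. gdet J (B z))"
  using assms(1)
proof (induction Z)
  case (insert z Z)
  let ?A = "\<lambda>(z, i) (z', j). if z = z' then B z i j else 0"
  have "bij_betw (Pair z) J ({z} \<times> J)" by (auto simp: bij_betw_def inj_on_def)
  then have 1: "gdet ({z} \<times> J) ?A = gdet J (B z)"
    using fin by (simp add: gdet_reindex)
  have "insert z Z \<times> J = ({z} \<times> J) \<union> (Z \<times> J)" by auto
  then have "gdet (insert z Z \<times> J) ?A = gdet ({z} \<times> J) ?A * gdet (Z \<times> J) ?A"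
    using insert.hyps fin by (auto intro!: gdet_block_upper_triangular)
  then show ?case using insert 1 by simp
qed simp

lemma gdet_diagonal:
  fixes c :: "'i \<Rightarrow> 'a::idom"
  assumes "finite I"
  shows "gdet I (\<lambda>i j. if i = j then c i else 0) = (\<Prod>i\<in>I. c i)"
  using assms
proof (induction I)
  case (insert i I)
  have "gdet ({i} \<union> I) (\<lambda>i j. if i = j then c i else 0) =
      gdet {i} (\<lambda>i j. if i = j then c i else 0) * gdet I (\<lambda>i j. if i = j then c i else 0)"
    using insert.hyps by (intro gdet_block_upper_triangular) auto
  then show ?case using insert by simp
qed simp

section \<open>Counting the kernel of a toral endomorphism\<close>

text \<open>The kernel of the endomorphism of the torus (R/Z)^I given by \<open>A\<close>, in
  representatives from [0,1). Extensionality off \<open>I\<close> makes each point of the torus a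
  single function.\<close>

definition box_solutions :: "'i set \<Rightarrow> ('i \<Rightarrow> 'i \<Rightarrow> int) \<Rightarrow> ('i \<Rightarrow> real) set" where
  "box_solutions I A = {x \<in> I \<rightarrow>\<^sub>E {0..<1}. \<forall>i\<in>I. (\<Sum>j\<in>I. of_int (A i j) * x j) \<in> \<int>}"

text \<open>While \<open>t\<close> runs through [0,1), the value a t + s runs through a half-open
  interval of integer length \<open>a\<close>, which contains exactly \<open>a\<close> integers
  wherever it starts.\<close>

lemma card_affine_Ints_pos:
  fixes s :: real and a :: int
  assumes "a > 0"
  shows "finite {t \<in> {0..<1}. of_int a * t + s \<in> \<int>} \<and> card {t \<in> {0..<1}. of_int a * t + s \<in> \<int>} = nat a"
proof -
  have "{t \<in> {0..<1}. of_int a * t + s \<in> \<int>} = (\<lambda>k. (of_int k - s) / of_int a) ` {\<lceil>s\<rceil>..<\<lceil>s\<rceil> + a}"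
  proof (intro equalityI subsetI)
    fix t assume "t \<in> {t \<in> {0..<1}. of_int a * t + s \<in> \<int>}"
    then obtain k where t: "0 \<le> t" "t < 1" and k: "of_int a * t + s = of_int k"
      by (auto elim: Ints_cases)
    have "of_int k \<ge> s" using k t assms by (smt (verit) mult_nonneg_nonneg of_int_pos)
    moreover have "of_int a * t < of_int a" using t assms by simp
    then have "of_int (k - a) < s" using k by simp
    then have "k - a < \<lceil>s\<rceil>" by (simp only: less_ceiling_iff)
    ultimately have "k \<in> {\<lceil>s\<rceil>..<\<lceil>s\<rceil> + a}" by (simp add: ceiling_le_iff)
    moreover have "t = (of_int k - s) / of_int a" using k assms by (simp add: field_simps)
    ultimately show "t \<in> (\<lambda>k. (of_int k - s) / of_int a) ` {\<lceil>s\<rceil>..<\<lceil>s\<rceil> + a}" by blast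
  next
    fix t assume "t \<in> (\<lambda>k. (of_int k - s) / of_int a) ` {\<lceil>s\<rceil>..<\<lceil>s\<rceil> + a}"
    then obtain k where k: "\<lceil>s\<rceil> \<le> k" "k < \<lceil>s\<rceil> + a" and t: "t = (of_int k - s) / of_int a" by auto
    have "s \<le> of_int k" using k by (simp add: ceiling_le_iff)
    moreover have "k - a < \<lceil>s\<rceil>" using k by simp
    then have "of_int (k - a) < s" by (simp only: less_ceiling_iff)
    moreover have "of_int a * t + s = of_int k" using t assms by simp
    ultimately show "t \<in> {t \<in> {0..<1}. of_int a * t + s \<in> \<int>}"
      using assms unfolding t by simp
  qed
  moreover have "inj_on (\<lambda>k. (of_int k - s) / of_int a) {\<lceil>s\<rceil>..<\<lceil>s\<rceil> + a}"
    using assms by (auto simp: inj_on_def)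
  ultimately show ?thesis by (simp add: card_image)
qed

lemma card_affine_Ints:
  fixes s :: real and a :: int
  assumes "a \<noteq> 0"
  shows "finite {t \<in> {0..<1}. of_int a * t + s \<in> \<int>} \<and> card {t \<in> {0..<1}. of_int a * t + s \<in> \<int>} = nat \<bar>a\<bar>"
proof (cases "a > 0")
  case True
  then show ?thesis using card_affine_Ints_pos[of a s] by simp
next
  case False
  have "of_int (- a) * t + - s \<in> \<int> \<longleftrightarrow> of_int a * t + s \<in> \<int>" for t
    using minus_in_Ints_iff[of "of_int a * t + s"] by simp
  then show ?thesis using card_affine_Ints_pos[of "-a" "-s"] False assms by simp
qed

text \<open>The rows in \<open>I\<close> do not involve coordinate \<open>j\<close>, so solutions
  project to solutions over \<open>I\<close>. The fibre over \<open>x\<close> is cut out by row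
  \<open>j\<close> alone, an affine condition whose number of solutions does not depend on
  \<open>x\<close>.\<close>

lemma box_solutions_insert:
  assumes fin: "finite I" and j: "j \<notin> I" and z: "\<And>i. i \<in> I \<Longrightarrow> A i j = 0"
    and a: "A j j \<noteq> 0" and fs: "finite (box_solutions I A)"
  shows "finite (box_solutions (insert j I) A) \<and>
     card (box_solutions (insert j I) A) = nat \<bar>A j j\<bar> * card (box_solutions I A)"
proof -
  define T where "T = (\<lambda>x. {t \<in> {0..<1::real}. of_int (A j j) * t + (\<Sum>k\<in>I. of_int (A j k) * x k) \<in> \<int>})"
  have T: "finite (T x)" "card (T x) = nat \<bar>A j j\<bar>" for x
    unfolding T_def using card_affine_Ints[OF a] by auto
  have "bij_betw (\<lambda>(x, t). x(j := t)) (SIGMA x:box_solutions I A. T x) (box_solutions (insert j I) A)"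
  proof (rule bij_betw_byWitness[where f'="\<lambda>y. (restrict y I, y j)"])
    have upd: "(\<Sum>k\<in>I. of_int (A i k) * (x(j := t)) k) = (\<Sum>k\<in>I. of_int (A i k) * x k)"
      for i t and x :: "_ \<Rightarrow> real" using j by (intro sum.cong) auto
    show "(\<lambda>(x, t). x(j := t)) ` (SIGMA x:box_solutions I A. T x) \<subseteq> box_solutions (insert j I) A"
      using fin j z by (auto simp: box_solutions_def T_def upd simp del: fun_upd_apply
          intro!: PiE_fun_upd) (auto simp: upd)
    show "(\<lambda>y. (restrict y I, y j)) ` box_solutions (insert j I) A \<subseteq> (SIGMA x:box_solutions I A. T x)"
      using fin j z by (auto simp: box_solutions_def T_def PiE_iff)
    show "\<forall>p\<in>SIGMA x:box_solutions I A. T x. (\<lambda>y. (restrict y I, y j)) (case p of (x, t) \<Rightarrow> x(j := t)) = p"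
      using j by (auto simp: box_solutions_def fun_eq_iff restrict_def PiE_iff extensional_def)
    show "\<forall>y\<in>box_solutions (insert j I) A. (case (restrict y I, y j) of (x, t) \<Rightarrow> x(j := t)) = y"
      by (auto simp: box_solutions_def fun_eq_iff restrict_def PiE_iff extensional_def)
  qed
  note bij = this
  have "finite (SIGMA x:box_solutions I A. T x)" using fs T by (intro finite_SigmaI) auto
  then have 1: "finite (box_solutions (insert j I) A)" using bij bij_betw_finite by blast
  have "card (box_solutions (insert j I) A) = card (SIGMA x:box_solutions I A. T x)"
    using bij by (simp add: bij_betw_same_card)
  also have "\<dots> = nat \<bar>A j j\<bar> * card (box_solutions I A)"
    using fs T by (simp add: card_SigmaI)
  finally show ?thesis using 1 by simp
qed

text \<open>Row \<open>i\<close> changes by an integer multiple of row \<open>k\<close>; since row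
  \<open>k\<close> itself stays, the operation can be undone over the integers.\<close>

lemma box_solutions_addrow:
  assumes fin: "finite I" and i: "i \<in> I" and k: "k \<in> I" and ne: "i \<noteq> k"
  shows "box_solutions I (A(i := (\<lambda>j. c * A k j + A i j))) = box_solutions I A"
proof -
  define L where "L = (\<lambda>(x::_\<Rightarrow>real) i. \<Sum>j\<in>I. of_int (A i j) * x j)"
  have row: "(\<Sum>j\<in>I. of_int ((A(i := (\<lambda>j. c * A k j + A i j))) l j) * x j) =
     (if l = i then of_int c * L x k + L x i else L x l)" for x l
    by (simp add: L_def sum_distrib_left sum.distrib[symmetric] algebra_simps)
  have "(\<forall>l\<in>I. (if l = i then of_int c * L x k + L x i else L x l) \<in> \<int>) \<longleftrightarrow> (\<forall>l\<in>I. L x l \<in> \<int>)" for x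
  proof
    assume a: "\<forall>l\<in>I. (if l = i then of_int c * L x k + L x i else L x l) \<in> \<int>"
    then have "L x k \<in> \<int>" "of_int c * L x k + L x i \<in> \<int>" using i k ne by auto
    then have "(of_int c * L x k + L x i) - of_int c * L x k \<in> \<int>"
      by (intro Ints_diff Ints_mult) auto
    then have "L x i \<in> \<int>" by simp
    then show "\<forall>l\<in>I. L x l \<in> \<int>" using a by metis
  qed (use i k in \<open>auto intro!: Ints_add Ints_mult\<close>)
  then show ?thesis unfolding box_solutions_def row by (simp add: L_def)
qed

lemma box_solutions_swaprows:
  assumes "i \<in> I" and "k \<in> I"
  shows "box_solutions I (A(i := A k, k := A i)) = box_solutions I A"
  unfolding box_solutions_def using assms by (auto split: if_splits)

text \<open>Induction on \<open>I\<close>. Euclid's algorithm on column \<open>j\<close>, by row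
  operations that preserve the solutions and the absolute determinant, leaves one nonzero entry in
  that column; then one coordinate splits off.\<close>

theorem card_box_solutions:
  fixes A :: "'i \<Rightarrow> 'i \<Rightarrow> int"
  assumes "finite I" and "gdet I A \<noteq> 0"
  shows "finite (box_solutions I A) \<and> card (box_solutions I A) = nat \<bar>gdet I A\<bar>"
  using assms
proof (induction I arbitrary: A)
  case empty
  then show ?case by (simp add: box_solutions_def)
next
  case (insert j I)
  \<comment> \<open>Once column \<open>j\<close> is zero off the diagonal, \<open>A j j\<close>
    splits off from the determinant and from the count alike.\<close>
  have pivot: "finite (box_solutions (insert j I) A) \<and>
      card (box_solutions (insert j I) A) = nat \<bar>gdet (insert j I) A\<bar>"
    if z: "\<And>i. i \<in> I \<Longrightarrow> A i j = 0" and nz: "gdet (insert j I) A \<noteq> 0"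
    for A :: "'i \<Rightarrow> 'i \<Rightarrow> int"
  proof -
    have "gdet (insert j I) A = A j j * gdet I A"
      using gdet_block_upper_triangular[of "{j}" I A] insert.hyps z by simp
    moreover from this nz have "gdet I A \<noteq> 0" "A j j \<noteq> 0" by auto
    ultimately show ?thesis
      using insert.IH[of A] box_solutions_insert[of I j A] insert.hyps z
      by (simp add: abs_mult nat_mult_distrib)
  qed
  show ?case using insert.prems
  \<comment> \<open>The sum of the absolute entries of column \<open>j\<close> is the measure for
    Euclid's algorithm.\<close>
  proof (induction "\<Sum>i\<in>insert j I. nat \<bar>A i j\<bar>" arbitrary: A rule: less_induct)
    case (less A)
    let ?J = "insert j I"
    have fin: "finite ?J" using insert by simp
    show ?case
    proof (cases "\<exists>i\<in>?J. \<exists>k\<in>?J. i \<noteq> k \<and> A i j \<noteq> 0 \<and> A k j \<noteq> 0")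
      case True
      then obtain i k where ik: "i \<in> ?J" "k \<in> ?J" "i \<noteq> k" "A i j \<noteq> 0" "A k j \<noteq> 0" "\<bar>A k j\<bar> \<le> \<bar>A i j\<bar>"
        by (metis linear)
      \<comment> \<open>This sign makes \<open>c * A k j\<close> opposite to \<open>A i j\<close>,
        so the smaller absolute value is subtracted from the larger one.\<close>
      define c where "c = - sgn (A i j) * sgn (A k j)"
      define B where "B = A(i := (\<lambda>l. c * A k l + A i l))"
      have "\<bar>c * A k j + A i j\<bar> < \<bar>A i j\<bar>"
        using ik by (auto simp: c_def sgn_if)
      then have "nat \<bar>B i j\<bar> < nat \<bar>A i j\<bar>" by (simp add: B_def)
      then have "(\<Sum>i\<in>?J. nat \<bar>B i j\<bar>) < (\<Sum>i\<in>?J. nat \<bar>A i j\<bar>)"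
        using ik(1) by (intro sum_strict_mono_ex1[OF fin]) (auto simp: B_def)
      moreover have "gdet ?J B = gdet ?J A" "box_solutions ?J B = box_solutions ?J A"
        unfolding B_def using gdet_addrow[OF fin] box_solutions_addrow[OF fin] ik by metis+
      ultimately show ?thesis using less by metis
    next
      case False
      then have uniq: "A k j = 0" if "i \<in> ?J" "k \<in> ?J" "i \<noteq> k" "A i j \<noteq> 0" for i k
        using that by blast
      \<comment> \<open>A zero column would make the determinant vanish.\<close>
      obtain i where i: "i \<in> ?J" "A i j \<noteq> 0"
        using gdet_zero_column[OF fin, of j A] less.prems by auto
      show ?thesis
      proof (cases "i = j")
        case True
        then show ?thesis using uniq[of j] i insert.hyps less.prems by (intro pivot) auto
      next
        case ne: False
        \<comment> \<open>The only nonzero entry of column \<open>j\<close> lies off the diagonal in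
          row \<open>i\<close>. The swap moves it to the diagonal, and the absolute value absorbs
          the sign of the determinant.\<close>
        define B where "B = A(i := A j, j := A i)"
        have "gdet ?J B = - gdet ?J A" "box_solutions ?J B = box_solutions ?J A"
          unfolding B_def using gdet_swaprows[OF fin i(1) _ ne] box_solutions_swaprows[OF i(1)] by auto
        moreover have "B k j = 0" if "k \<in> I" for k
          using uniq[of i] i ne that insert.hyps by (auto simp: B_def)
        ultimately show ?thesis using pivot[of B] less.prems by simp
      qed
    qed
  qed
qed

section \<open>Non-archimedean fields and Laurent polynomials\<close>

locale nonarch_valued_field =
  fixes nv :: "'k::field_char_0 \<Rightarrow> real"
  assumes nv_nonneg [simp]: "nv x \<ge> 0"
    and nv_eq_0_iff [simp]: "nv x = 0 \<longleftrightarrow> x = 0"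
    and nv_mult: "nv (x * y) = nv x * nv y"
    and nv_add_le: "nv (x + y) \<le> max (nv x) (nv y)"
begin

lemma nv_0 [simp]: "nv 0 = 0"
  by simp

lemma nv_1 [simp]: "nv 1 = 1"
  using nv_mult[of 1 1] nv_eq_0_iff[of 1] by (simp del: nv_eq_0_iff)

lemma nv_pos_iff [simp]: "nv x > 0 \<longleftrightarrow> x \<noteq> 0"
  using nv_nonneg[of x] nv_eq_0_iff[of x] by linarith

lemma nv_power: "nv (x ^ n) = nv x ^ n"
  by (induction n) (simp_all add: nv_mult)

lemma nv_minus [simp]: "nv (- x) = nv x"
proof -
  have "nv (-1) ^ 2 = 1 ^ 2" by (simp flip: nv_power)
  then have "nv (-1) = 1" by (subst (asm) power_eq_iff_eq_base) auto
  then show ?thesis using nv_mult[of "-1" x] by simp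
qed

lemma nv_diff_le: "nv (x - y) \<le> max (nv x) (nv y)"
  using nv_add_le[of x "-y"] by simp

lemma nv_diff_commute: "nv (x - y) = nv (y - x)"
  using nv_minus[of "x - y"] by simp

lemma nv_diff_triangle_less: "nv (x - y) < e \<Longrightarrow> nv (y - z) < e \<Longrightarrow> nv (x - z) < e"
  using nv_add_le[of "x - y" "y - z"] by auto

lemma nv_inverse: "nv (inverse x) = inverse (nv x)"
proof (cases "x = 0")
  case False
  then have "nv x * nv (inverse x) = 1" by (simp flip: nv_mult)
  then show ?thesis by (simp add: inverse_unique)
qed simp

lemma nv_divide: "nv (x / y) = nv x / nv y"
  by (simp add: divide_inverse nv_mult nv_inverse)

lemma nv_power_int: "nv (x powi m) = nv x powi m"
  by (simp add: power_int_def nv_power nv_inverse)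

lemma nv_prod: "nv (\<Prod>i\<in>A. f i) = (\<Prod>i\<in>A. nv (f i))"
  by (induction A rule: infinite_finite_induct) (simp_all add: nv_mult)

text \<open>Writing \<open>x\<close> as \<open>(x + y) - y\<close>, the ultrametric inequality would
  give nv x <= nv y if \<open>x + y\<close> were smaller than \<open>x\<close>.\<close>

lemma nv_add_eq: "nv y < nv x \<Longrightarrow> nv (x + y) = nv x"
  using nv_add_le[of x y] nv_add_le[of "x + y" "-y"] by simp

lemma nv_sum_le:
  assumes "\<And>i. i \<in> A \<Longrightarrow> nv (f i) \<le> B" and "B \<ge> 0"
  shows "nv (\<Sum>i\<in>A. f i) \<le> B"
  using assms
proof (induction A rule: infinite_finite_induct)
  case (insert i A)
  then show ?case using nv_add_le[of "f i" "\<Sum>i\<in>A. f i"] by fastforce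
qed simp_all

lemma nv_sum_less:
  assumes "\<And>i. i \<in> A \<Longrightarrow> nv (f i) < B" and "B > 0"
  shows "nv (\<Sum>i\<in>A. f i) < B"
  using assms
proof (induction A rule: infinite_finite_induct)
  case (insert i A)
  then show ?case using nv_add_le[of "f i" "\<Sum>i\<in>A. f i"] by fastforce
qed simp_all

lemma root_of_unity_nv: "z ^ N = 1 \<Longrightarrow> N > 0 \<Longrightarrow> nv z = 1"
  using nv_power[of z N] by (intro power_eq_imp_eq_base[of "nv z" N 1]) auto

end

locale alg_closed_nonarch_field = nonarch_valued_field nv
  for nv :: "'k::field_char_0 \<Rightarrow> real" +
  assumes alg_closed: "degree (q :: 'k poly) > 0 \<Longrightarrow> \<exists>x. poly q x = 0"
begin

text \<open>The elementary substitute for reducing modulo the maximal ideal: a polynomial all of whose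
  roots lie off the unit circle has a reduction that is a monomial.\<close>

lemma dominant_coeff:
  fixes q :: "'k poly"
  assumes "q \<noteq> 0" and "\<And>x. poly q x = 0 \<Longrightarrow> nv x \<noteq> 1"
  shows "\<exists>k. \<forall>i. i \<noteq> k \<longrightarrow> nv (coeff q i) < nv (coeff q k)"
  using assms
proof (induction "degree q" arbitrary: q)
  case 0
  then obtain c where "q = [:c:]" "c \<noteq> 0" by (metis degree_eq_zeroE pCons_0_0)
  then show ?case by (intro exI[of _ 0]) (auto simp: coeff_pCons split: nat.splits)
next
  case (Suc n)
  then obtain x where x: "poly q x = 0" using alg_closed[of q] by auto
  then obtain r where r: "q = [:-x, 1:] * r" using poly_eq_0_iff_dvd by blast
  have r0: "r \<noteq> 0" using r Suc.prems by auto
  then have "degree q = Suc (degree r)" unfolding r by (subst degree_mult_eq) auto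
  then have "degree r = n" using Suc.hyps(2) by simp
  moreover have "nv y \<noteq> 1" if "poly r y = 0" for y using Suc.prems(2)[of y] that r by simp
  ultimately obtain k where k: "\<And>i. i \<noteq> k \<Longrightarrow> nv (coeff r i) < nv (coeff r k)"
    using Suc.hyps(1)[of r] r0 by blast
  \<comment> \<open>Strict dominance over any other index, here \<open>Suc k\<close>, forces the
    maximum to be nonzero.\<close>
  have rk: "nv (coeff r k) > 0" using k[of "Suc k"] nv_nonneg[of "coeff r (Suc k)"] by linarith
  have le: "nv (coeff r i) \<le> nv (coeff r k)" for i using k[of i] by (cases "i = k") auto
  \<comment> \<open>\<open>c\<close> lists the coefficients of X r, so that q = X r - x r.\<close>
  define c where "c = (\<lambda>i. case i of 0 \<Rightarrow> 0 | Suc j \<Rightarrow> coeff r j)"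
  have q: "coeff q i = c i - x * coeff r i" for i
    by (simp add: r c_def coeff_pCons split: nat.splits)
  have cle: "nv (c i) \<le> nv (coeff r k)" for i using le rk by (auto simp: c_def split: nat.splits)
  have cless: "nv (c i) < nv (coeff r k)" if "i \<noteq> Suc k" for i
    using k rk that by (auto simp: c_def split: nat.splits)
  \<comment> \<open>For nv x < 1 the summand X r dominates and the index moves to
    \<open>Suc k\<close>; for nv x > 1 the summand x r dominates and the index stays at
    \<open>k\<close>.\<close>
  consider "nv x < 1" | "nv x > 1" using Suc.prems(2)[OF x] by linarith
  then show ?case
  proof cases
    case 1
    have less: "nv (x * coeff r i) < nv (coeff r k)" for i
      using mult_left_mono[OF le nv_nonneg[of x], of i] mult_strict_right_mono[OF 1 rk]
      unfolding nv_mult by linarith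
    have "nv (coeff q (Suc k)) = nv (coeff r k)"
      using nv_add_eq[of "- (x * coeff r (Suc k))" "coeff r k"] less[of "Suc k"] by (simp add: q c_def)
    moreover have "nv (coeff q i) < nv (coeff r k)" if "i \<noteq> Suc k" for i
      using cless[OF that] less[of i] nv_diff_le[of "c i" "x * coeff r i"] by (simp add: q)
    ultimately show ?thesis by (intro exI[of _ "Suc k"]) auto
  next
    case 2
    have big: "nv (coeff r k) < nv (x * coeff r k)"
      using mult_strict_right_mono[OF 2 rk] by (simp add: nv_mult)
    have "nv (coeff q k) = nv (x * coeff r k)"
      using nv_add_eq[of "c k" "- (x * coeff r k)"] big cle[of k] by (simp add: q)
    moreover have "nv (coeff q i) < nv (x * coeff r k)" if "i \<noteq> k" for i
    proof -
      have "nv (x * coeff r i) < nv (x * coeff r k)"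
        using mult_strict_left_mono[OF k[OF that], of "nv x"] 2 unfolding nv_mult by linarith
      then show ?thesis using cle[of i] big nv_diff_le[of "c i" "x * coeff r i"] by (simp add: q)
    qed
    ultimately show ?thesis by (intro exI[of _ k]) auto
  qed
qed

section \<open>Roots of unity and their power sums\<close>

lemma card_roots_rsquarefree:
  fixes q :: "'k poly"
  assumes "rsquarefree q"
  shows "card {x. poly q x = 0} = degree q"
  using assms
proof (induction "degree q" arbitrary: q)
  case 0
  then obtain c where "q = [:c:]" "c \<noteq> 0" by (metis degree_eq_zeroE pCons_0_0 rsquarefree_def)
  then show ?case by simp
next
  case (Suc n)
  then obtain x where x: "poly q x = 0" using alg_closed[of q] by auto
  then obtain r where r: "q = [:-x, 1:] * r" using poly_eq_0_iff_dvd by blast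
  have q0: "q \<noteq> 0" using Suc.prems by (simp add: rsquarefree_def)
  then have r0: "r \<noteq> 0" using r by auto
  then have "degree q = Suc (degree r)" unfolding r by (subst degree_mult_eq) auto
  then have deg: "degree r = n" using Suc.hyps(2) by simp
  \<comment> \<open>At \<open>x\<close> the product rule leaves the value of \<open>r\<close>, so
    the simple root \<open>x\<close> of \<open>q\<close> is no longer a root of
    \<open>r\<close>.\<close>
  have pd: "pderiv q = [:-x, 1:] * pderiv r + r"
    unfolding r by (subst pderiv_mult) (simp add: pderiv_pCons algebra_simps)
  have sf: "\<not> (poly q a = 0 \<and> poly (pderiv q) a = 0)" for a
    using Suc.prems unfolding rsquarefree_roots by blast
  have rx: "poly r x \<noteq> 0" using sf[of x] x by (simp add: pd)
  have "\<not> (poly r a = 0 \<and> poly (pderiv r) a = 0)" for a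
  proof
    assume a: "poly r a = 0 \<and> poly (pderiv r) a = 0"
    then have "poly q a = 0" unfolding r by simp
    moreover have "poly (pderiv q) a = 0" using a unfolding pd by simp
    ultimately show False using sf[of a] by blast
  qed
  then have "rsquarefree r" unfolding rsquarefree_roots by blast
  then have "card {y. poly r y = 0} = n" using Suc.hyps(1)[of r] deg by simp
  moreover have "{y. poly q y = 0} = insert x {y. poly r y = 0}" by (auto simp: r)
  ultimately show ?case using Suc.hyps(2) rx poly_roots_finite[OF r0] by simp
qed

lemma finite_roots_of_unity: "N > 0 \<Longrightarrow> finite (roots_of_unity N :: 'k set)"
  using poly_roots_finite[of "monom 1 N - 1 :: 'k poly"]
  by (auto simp: roots_of_unity_def poly_monom monom_eq_1_iff)

text \<open>X^N - 1 is squarefree: in characteristic 0 its derivative can vanish only at 0, which is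
  not a root.\<close>

lemma card_roots_of_unity:
  assumes "N > 0"
  shows "card (roots_of_unity N :: 'k set) = N"
proof -
  define q :: "'k poly" where "q = monom 1 N - 1"
  have "rsquarefree q"
    using assms unfolding rsquarefree_roots q_def
    by (auto simp: pderiv_diff pderiv_monom poly_monom power_0_left)
  moreover have "degree q = N"
    unfolding q_def using assms
    by (subst diff_conv_add_uminus, subst degree_add_eq_left) (auto simp: degree_monom_eq)
  moreover have "{x. poly q x = 0} = roots_of_unity N"
    by (auto simp: q_def roots_of_unity_def poly_monom)
  ultimately show ?thesis using card_roots_rsquarefree by metis
qed

text \<open>Multiplication by a root of unity \<open>\<eta>\<close> permutes the roots and
  multiplies the sum by \<open>\<eta> powi m\<close>. For nonzero \<open>m\<close> some
  \<open>\<eta>\<close> gives a factor other than 1, because only |m| < N elements satisfy z^|m| =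
  1.\<close>

lemma sum_powi_roots_of_unity:
  assumes "N > 0" and "\<bar>m\<bar> < int N"
  shows "(\<Sum>\<zeta>\<in>roots_of_unity N. \<zeta> powi m) = (if m = 0 then of_nat N else (0::'k))"
proof (cases "m = 0")
  case True
  then show ?thesis using assms by (simp add: card_roots_of_unity)
next
  case False
  let ?R = "roots_of_unity N :: 'k set"
  have nz: "\<zeta> \<noteq> 0" if "\<zeta> \<in> ?R" for \<zeta> using that assms by (auto simp: roots_of_unity_def power_0_left)
  have "\<exists>\<eta>\<in>?R. \<eta> powi m \<noteq> 1"
  proof (rule ccontr)
    assume "\<not> ?thesis"
    then have "\<zeta> powi m = 1" if "\<zeta> \<in> ?R" for \<zeta> using that by blast
    then have "\<zeta> ^ nat \<bar>m\<bar> = 1" if "\<zeta> \<in> ?R" for \<zeta>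
      using that by (cases "m \<ge> 0") (force simp: power_int_def power_inverse)+
    then have "?R \<subseteq> roots_of_unity (nat \<bar>m\<bar>)" by (auto simp: roots_of_unity_def)
    then have "card ?R \<le> card (roots_of_unity (nat \<bar>m\<bar>) :: 'k set)"
      using False by (intro card_mono finite_roots_of_unity) auto
    then show False using assms False by (simp add: card_roots_of_unity)
  qed
  then obtain \<eta> where \<eta>: "\<eta> \<in> ?R" "\<eta> powi m \<noteq> 1" by blast
  have "bij_betw (\<lambda>\<zeta>. \<eta> * \<zeta>) ?R ?R"
    using \<eta> nz[OF \<eta>(1)]
    by (intro bij_betw_byWitness[where f'="\<lambda>\<zeta>. \<zeta> / \<eta>"])
       (auto simp: roots_of_unity_def power_mult_distrib power_divide)
  then have "(\<Sum>\<zeta>\<in>?R. \<zeta> powi m) = (\<Sum>\<zeta>\<in>?R. (\<eta> * \<zeta>) powi m)"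
    by (rule sum.reindex_bij_betw[symmetric])
  also have "\<dots> = \<eta> powi m * (\<Sum>\<zeta>\<in>?R. \<zeta> powi m)"
    by (simp add: power_int_mult_distrib sum_distrib_left)
  finally have "(\<eta> powi m - 1) * (\<Sum>\<zeta>\<in>?R. \<zeta> powi m) = 0" by (simp add: algebra_simps)
  then show ?thesis using \<eta> False by simp
qed

end

section \<open>Sums and cardinalities over boxes of vectors\<close>

lemma sum_prod_vec:
  fixes f :: "'d::finite \<Rightarrow> 'a \<Rightarrow> 'b::comm_semiring_1"
  assumes "\<And>k. finite (B k)"
  shows "(\<Sum>z\<in>{z::'a^'d. \<forall>k. z $ k \<in> B k}. \<Prod>k\<in>UNIV. f k (z $ k)) = (\<Prod>k\<in>UNIV. \<Sum>x\<in>B k. f k x)"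
proof -
  have "(\<Sum>z\<in>{z::'a^'d. \<forall>k. z $ k \<in> B k}. \<Prod>k\<in>UNIV. f k (z $ k)) =
      (\<Sum>g\<in>PiE UNIV B. \<Prod>k\<in>UNIV. f k (g k))"
    by (rule sum.reindex_bij_witness[where i=vec_lambda and j=vec_nth]) auto
  then show ?thesis using assms by (simp add: prod_sum_PiE)
qed

lemma finite_vec_set:
  assumes "\<And>k::'d::finite. finite (B k)"
  shows "finite {z::'a^'d. \<forall>k. z $ k \<in> B k}"
proof -
  have "{z::'a^'d. \<forall>k. z $ k \<in> B k} = vec_lambda ` PiE UNIV B"
    by (force simp: image_iff intro!: exI[of _ "vec_nth _"])
  then show ?thesis using assms by (simp add: finite_PiE)
qed

lemma card_vec_set:
  assumes "\<And>k::'d::finite. finite (B k)"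
  shows "card {z::'a^'d. \<forall>k. z $ k \<in> B k} = (\<Prod>k\<in>UNIV. card (B k))"
proof -
  have "bij_betw vec_lambda (PiE UNIV B) {z::'a^'d. \<forall>k. z $ k \<in> B k}"
    by (rule bij_betw_byWitness[where f'=vec_nth]) auto
  then show ?thesis using assms by (simp add: bij_betw_same_card[symmetric] card_PiE)
qed

section \<open>Laurent polynomials as functions\<close>

definition lmonom :: "'a::field^'d::finite \<Rightarrow> int^'d \<Rightarrow> 'a" where
  "lmonom z \<nu> = (\<Prod>k\<in>UNIV. (z $ k) powi (\<nu> $ k))"

text \<open>Only points with nonzero coordinates are constrained, since \<open>lmonom\<close> turns
  sums of exponents into products there. The existential form gives closure under ring operations
  without naming coefficients.\<close>

definition laurent_fun :: "('a::field^'d::finite \<Rightarrow> 'a) \<Rightarrow> bool" where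
  "laurent_fun F \<longleftrightarrow> (\<exists>S c. finite S \<and> (\<forall>z. (\<forall>k. z $ k \<noteq> 0) \<longrightarrow> F z = (\<Sum>\<nu>\<in>S. c \<nu> * lmonom z \<nu>)))"

lemma lmonom_add:
  "(\<And>k. z $ k \<noteq> 0) \<Longrightarrow> lmonom z (\<mu> + \<nu>) = lmonom z \<mu> * lmonom z \<nu>"
  by (simp add: lmonom_def power_int_add prod.distrib)

lemma lmonom_0 [simp]: "lmonom z 0 = 1"
  by (simp add: lmonom_def)

lemma laurent_funI:
  "finite S \<Longrightarrow> (\<And>z. (\<And>k. z $ k \<noteq> 0) \<Longrightarrow> F z = (\<Sum>\<nu>\<in>S. c \<nu> * lmonom z \<nu>)) \<Longrightarrow> laurent_fun F"
  unfolding laurent_fun_def by blast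

lemma laurent_fun_const: "laurent_fun (\<lambda>z. c)"
  by (rule laurent_funI[of "{0}" _ "\<lambda>_. c"]) auto

lemma laurent_fun_lmonom_mult:
  assumes "laurent_fun F"
  shows "laurent_fun (\<lambda>z. a * lmonom z \<mu> * F z)"
proof -
  obtain S c where S: "finite S" "\<And>z. (\<And>k. z $ k \<noteq> 0) \<Longrightarrow> F z = (\<Sum>\<nu>\<in>S. c \<nu> * lmonom z \<nu>)"
    using assms unfolding laurent_fun_def by blast
  show ?thesis
  proof (rule laurent_funI[of "(+) \<mu> ` S" _ "\<lambda>\<nu>. a * c (\<nu> - \<mu>)"])
    fix z :: "'a^'b" assume "\<And>k. z $ k \<noteq> 0"
    then show "a * lmonom z \<mu> * F z = (\<Sum>\<nu>\<in>(+) \<mu> ` S. a * c (\<nu> - \<mu>) * lmonom z \<nu>)"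
      using S by (subst sum.reindex) (auto simp: lmonom_add sum_distrib_left ac_simps inj_on_def)
  qed (use S in auto)
qed

lemma laurent_fun_add:
  assumes "laurent_fun F" "laurent_fun G"
  shows "laurent_fun (\<lambda>z. F z + G z)"
proof -
  obtain S c where S: "finite S" "\<And>z. (\<And>k. z $ k \<noteq> 0) \<Longrightarrow> F z = (\<Sum>\<nu>\<in>S. c \<nu> * lmonom z \<nu>)"
    using assms unfolding laurent_fun_def by blast
  obtain S' c' where S': "finite S'" "\<And>z. (\<And>k. z $ k \<noteq> 0) \<Longrightarrow> G z = (\<Sum>\<nu>\<in>S'. c' \<nu> * lmonom z \<nu>)"
    using assms unfolding laurent_fun_def by blast
  show ?thesis
  proof (rule laurent_funI[of "S \<union> S'" _ "\<lambda>\<nu>. (if \<nu> \<in> S then c \<nu> else 0) + (if \<nu> \<in> S' then c' \<nu> else 0)"])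
    fix z :: "'a^'b" assume z: "\<And>k. z $ k \<noteq> 0"
    have "F z = (\<Sum>\<nu>\<in>S \<union> S'. (if \<nu> \<in> S then c \<nu> else 0) * lmonom z \<nu>)"
      unfolding S(2)[OF z] using S S' by (intro sum.mono_neutral_cong_left) auto
    moreover have "G z = (\<Sum>\<nu>\<in>S \<union> S'. (if \<nu> \<in> S' then c' \<nu> else 0) * lmonom z \<nu>)"
      unfolding S'(2)[OF z] using S S' by (intro sum.mono_neutral_cong_left) auto
    ultimately show "F z + G z = (\<Sum>\<nu>\<in>S \<union> S'. ((if \<nu> \<in> S then c \<nu> else 0) + (if \<nu> \<in> S' then c' \<nu> else 0)) * lmonom z \<nu>)"
      by (simp add: distrib_right sum.distrib)
  qed (use S S' in auto)
qed

lemma laurent_fun_sum: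
  "(\<And>i. i \<in> A \<Longrightarrow> laurent_fun (F i)) \<Longrightarrow> laurent_fun (\<lambda>z. \<Sum>i\<in>A. F i z)"
  by (induction A rule: infinite_finite_induct) (auto intro: laurent_fun_const laurent_fun_add)

lemma laurent_fun_cong:
  "laurent_fun F \<Longrightarrow> (\<And>z. (\<And>k. z $ k \<noteq> 0) \<Longrightarrow> F z = G z) \<Longrightarrow> laurent_fun G"
  unfolding laurent_fun_def by metis

lemma laurent_fun_mult:
  assumes "laurent_fun F" "laurent_fun G"
  shows "laurent_fun (\<lambda>z. F z * G z)"
proof -
  obtain S c where S: "finite S" "\<And>z. (\<And>k. z $ k \<noteq> 0) \<Longrightarrow> F z = (\<Sum>\<nu>\<in>S. c \<nu> * lmonom z \<nu>)"
    using assms unfolding laurent_fun_def by blast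
  have "laurent_fun (\<lambda>z. \<Sum>\<nu>\<in>S. c \<nu> * lmonom z \<nu> * G z)"
    by (intro laurent_fun_sum laurent_fun_lmonom_mult assms)
  then show ?thesis
    by (rule laurent_fun_cong) (simp add: S(2) sum_distrib_right)
qed

lemma laurent_fun_prod:
  "(\<And>i. i \<in> A \<Longrightarrow> laurent_fun (F i)) \<Longrightarrow> laurent_fun (\<lambda>z. \<Prod>i\<in>A. F i z)"
  by (induction A rule: infinite_finite_induct) (auto intro: laurent_fun_const laurent_fun_mult)

lemma laurent_fun_lmonom: "laurent_fun (\<lambda>z. lmonom z \<mu>)"
  using laurent_fun_lmonom_mult[OF laurent_fun_const, of 1 \<mu> 1] by simp

lemma laurent_fun_power: "laurent_fun F \<Longrightarrow> laurent_fun (\<lambda>z. F z ^ n)"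
  by (induction n) (auto intro: laurent_fun_const laurent_fun_mult)

lemma laurent_fun_det_laurent_eval: "laurent_fun (\<lambda>z::'k::field^'d::finite. det (laurent_eval a z))"
  unfolding det_def laurent_eval_def vec_lambda_beta
  by (intro laurent_fun_sum laurent_fun_mult laurent_fun_prod laurent_fun_const
        laurent_fun_lmonom[unfolded lmonom_def])

text \<open>A one-parameter subgroup separating finitely many characters of the torus.\<close>

lemma separating_cocharacter:
  fixes S :: "(int^'d::finite) set"
  assumes "finite S"
  shows "\<exists>m::int^'d. inj_on (\<lambda>\<nu>. \<Sum>k\<in>UNIV. \<nu> $ k * m $ k) S"
proof -
  obtain e :: "'d \<Rightarrow> nat" where e: "inj e"
    using finite_imp_inj_to_nat_seg[of "UNIV :: 'd set"] by auto
  \<comment> \<open>An exponent is encoded as an integer polynomial with coefficient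
    \<open>\<nu> $ k\<close> in degree \<open>e k\<close>. Its value at \<open>x\<close> is the
    pairing of \<open>\<nu>\<close> with the vector of the \<open>x ^ e k\<close>.\<close>
  define q :: "int^'d \<Rightarrow> int poly" where "q = (\<lambda>\<nu>. \<Sum>k\<in>UNIV. monom (\<nu> $ k) (e k))"
  have cq: "coeff (q \<nu>) (e k) = \<nu> $ k" for \<nu> k
    using e by (simp add: q_def coeff_sum inj_eq if_distrib cong: if_cong)
  \<comment> \<open>Differences of distinct encodings are nonzero polynomials, so only finitely many
    integers \<open>x\<close> fail to separate \<open>S\<close>.\<close>
  have "finite (\<Union>(\<mu>, \<nu>)\<in>{p\<in>S \<times> S. fst p \<noteq> snd p}. {x. poly (q \<mu> - q \<nu>) x = 0})"
  proof (intro finite_UN_I)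
    fix p assume "p \<in> {p\<in>S \<times> S. fst p \<noteq> snd p}"
    then have "fst p \<noteq> snd p" by simp
    then obtain k where "fst p $ k \<noteq> snd p $ k" by (metis vec_eq_iff)
    then have "coeff (q (fst p) - q (snd p)) (e k) \<noteq> 0" by (simp add: cq)
    then have "q (fst p) - q (snd p) \<noteq> 0" by (metis coeff_0)
    then show "finite (case p of (\<mu>, \<nu>) \<Rightarrow> {x. poly (q \<mu> - q \<nu>) x = 0})"
      unfolding case_prod_beta by (rule poly_roots_finite)
  qed (use assms in auto)
  then obtain x where x: "x \<notin> (\<Union>(\<mu>, \<nu>)\<in>{p\<in>S \<times> S. fst p \<noteq> snd p}. {x. poly (q \<mu> - q \<nu>) x = 0})"
    using ex_new_if_finite[OF infinite_UNIV_int] by blast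
  have "inj_on (\<lambda>\<nu>. \<Sum>k\<in>UNIV. \<nu> $ k * (\<chi> k. x ^ e k) $ k) S"
  proof (rule inj_onI)
    fix \<mu> \<nu> assume "\<mu> \<in> S" "\<nu> \<in> S"
      and "(\<Sum>k\<in>UNIV. \<mu> $ k * (\<chi> k. x ^ e k) $ k) = (\<Sum>k\<in>UNIV. \<nu> $ k * (\<chi> k. x ^ e k) $ k)"
    then have "poly (q \<mu> - q \<nu>) x = 0" by (simp add: q_def poly_sum poly_monom)
    then show "\<mu> = \<nu>" using x \<open>\<mu> \<in> S\<close> \<open>\<nu> \<in> S\<close> by auto
  qed
  then show ?thesis by blast
qed

section \<open>Dominant terms and averages of Laurent polynomials\<close>

context alg_closed_nonarch_field
begin

text \<open>Along a separating one-parameter subgroup the exponents stay distinct. Up to a power of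
  the variable, the pullback of \<open>F\<close> is thus a polynomial in one variable with the same
  coefficients and no root of absolute value 1, and \<open>dominant_coeff\<close> applies.\<close>

lemma laurent_dominant_term:
  fixes F :: "'k^'d::finite \<Rightarrow> 'k"
  assumes fin: "finite S" and F: "\<And>z. z \<in> torus_p nv \<Longrightarrow> F z = (\<Sum>\<nu>\<in>S. c \<nu> * lmonom z \<nu>)"
    and nz: "\<And>z. z \<in> torus_p nv \<Longrightarrow> F z \<noteq> 0"
  shows "\<exists>\<nu>\<in>S. c \<nu> \<noteq> 0 \<and> (\<forall>\<mu>\<in>S - {\<nu>}. nv (c \<mu>) < nv (c \<nu>))"
proof -
  obtain m :: "int^'d" where m: "inj_on (\<lambda>\<nu>. \<Sum>k\<in>UNIV. \<nu> $ k * m $ k) S"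
    using separating_cocharacter[OF fin] by blast
  define E where "E = (\<lambda>\<nu>. \<Sum>k\<in>UNIV. \<nu> $ k * m $ k)"
  \<comment> \<open>Shifting by \<open>M\<close> makes all exponents of the pullback
    nonnegative.\<close>
  define M where "M = (\<Sum>\<nu>\<in>S. \<bar>E \<nu>\<bar>)"
  have M: "E \<nu> + M \<ge> 0" if "\<nu> \<in> S" for \<nu>
    using member_le_sum[of \<nu> S "\<lambda>\<nu>. \<bar>E \<nu>\<bar>"] that fin unfolding M_def by linarith
  define d where "d = (\<lambda>\<nu>. nat (E \<nu> + M))"
  have d: "d \<mu> = d \<nu> \<longleftrightarrow> \<mu> = \<nu>" if "\<mu> \<in> S" "\<nu> \<in> S" for \<mu> \<nu>
  proof -
    have "d \<mu> = d \<nu> \<longleftrightarrow> E \<mu> = E \<nu>" using M[OF that(1)] M[OF that(2)] unfolding d_def by linarith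
    then show ?thesis using that m by (auto simp: E_def inj_on_def)
  qed
  define q where "q = (\<Sum>\<nu>\<in>S. monom (c \<nu>) (d \<nu>))"
  have coeff_q: "coeff q i = (\<Sum>\<nu>\<in>S. if d \<nu> = i then c \<nu> else 0)" for i
    by (simp add: q_def coeff_sum)
  have cq: "coeff q (d \<nu>) = c \<nu>" if "\<nu> \<in> S" for \<nu>
  proof -
    have "coeff q (d \<nu>) = (\<Sum>\<mu>\<in>S. if \<mu> = \<nu> then c \<mu> else 0)"
      unfolding coeff_q using that by (intro sum.cong) (auto simp: d)
    then show ?thesis using that fin by simp
  qed
  have pq: "poly q w \<noteq> 0" if w: "nv w = 1" for w
  proof -
    define z :: "'k^'d" where "z = (\<chi> k. w powi (m $ k))"
    have w0: "w \<noteq> 0" using w by auto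
    have z: "z \<in> torus_p nv" using w by (simp add: torus_p_def z_def nv_power_int)
    have "w ^ d \<nu> = w powi M * lmonom z \<nu>" if "\<nu> \<in> S" for \<nu>
    proof -
      have "lmonom z \<nu> = (\<Prod>k\<in>UNIV. w powi (\<nu> $ k * m $ k))"
        unfolding lmonom_def z_def
        by (intro prod.cong refl) (subst mult.commute, subst power_int_mult, simp)
      also have "\<dots> = w powi E \<nu>"
      proof -
        have "(\<Prod>k\<in>A. w powi (\<nu> $ k * m $ k)) = w powi (\<Sum>k\<in>A. \<nu> $ k * m $ k)" if "finite A" for A
          using that by induction (auto simp: power_int_add w0)
        then show ?thesis by (simp add: E_def)
      qed
      finally have "w powi M * lmonom z \<nu> = w powi (E \<nu> + M)" by (simp add: power_int_add w0)
      then show ?thesis using M[OF that] by (simp add: power_int_def d_def)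
    qed
    then have "(\<Sum>\<nu>\<in>S. c \<nu> * w ^ d \<nu>) = (\<Sum>\<nu>\<in>S. w powi M * (c \<nu> * lmonom z \<nu>))"
      by (intro sum.cong) auto
    then have "poly q w = w powi M * F z"
      unfolding F[OF z] by (simp add: q_def poly_sum poly_monom sum_distrib_left)
    then show ?thesis using nz[OF z] w0 by simp
  qed
  have "q \<noteq> 0" using pq[of 1] by auto
  then obtain k where k: "\<And>i. i \<noteq> k \<Longrightarrow> nv (coeff q i) < nv (coeff q k)"
    using dominant_coeff[of q] pq by blast
  have "nv (coeff q k) > 0" using k[of "Suc k"] nv_nonneg[of "coeff q (Suc k)"] by linarith
  then have "coeff q k \<noteq> 0" by simp
  \<comment> \<open>A nonzero coefficient of \<open>q\<close> can only come from an exponent in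
    \<open>S\<close>.\<close>
  have "\<exists>\<nu>\<in>S. d \<nu> = k"
  proof (rule ccontr)
    assume "\<not> ?thesis"
    then have "coeff q k = 0" unfolding coeff_q by (intro sum.neutral) auto
    then show False using \<open>coeff q k \<noteq> 0\<close> by simp
  qed
  then obtain \<nu> where \<nu>: "\<nu> \<in> S" "d \<nu> = k" by blast
  have "c \<nu> \<noteq> 0" using cq[OF \<nu>(1)] \<nu>(2) \<open>coeff q k \<noteq> 0\<close> by simp
  moreover have "nv (c \<mu>) < nv (c \<nu>)" if "\<mu> \<in> S - {\<nu>}" for \<mu>
    using k[of "d \<mu>"] d[of \<mu> \<nu>] cq[of \<mu>] cq[of \<nu>] \<nu> that by simp
  ultimately show ?thesis using \<nu> by blast
qed

text \<open>\<open>C\<close> is the constant coefficient. From \<open>N0\<close> on, every component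
  of every exponent is smaller than \<open>N\<close> in absolute value, so
  \<open>sum_powi_roots_of_unity\<close> kills all other monomials.\<close>

lemma laurent_average:
  fixes G :: "'k^'d::finite \<Rightarrow> 'k"
  assumes "laurent_fun G"
  shows "\<exists>C N0. \<forall>N\<ge>N0. N > 0 \<longrightarrow>
     (1 / of_nat N ^ CARD('d)) * (\<Sum>\<zeta>\<in>{\<zeta>::'k^'d. \<forall>i. \<zeta> $ i \<in> roots_of_unity N}. G \<zeta>) = C"
proof -
  obtain S c where S: "finite S" and G: "\<And>z. (\<And>k. z $ k \<noteq> 0) \<Longrightarrow> G z = (\<Sum>\<nu>\<in>S. c \<nu> * lmonom z \<nu>)"
    using assms unfolding laurent_fun_def by blast
  define N0 where "N0 = Suc (nat (\<Sum>\<nu>\<in>S. \<Sum>k\<in>UNIV. \<bar>\<nu> $ k\<bar>))"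
  define C where "C = (if 0 \<in> S then c 0 else 0)"
  show ?thesis
  proof (intro exI allI impI)
    fix N assume N: "N \<ge> N0" "N > 0"
    have small: "\<bar>\<nu> $ k\<bar> < int N" if "\<nu> \<in> S" for \<nu> k
    proof -
      have "\<bar>\<nu> $ k\<bar> \<le> (\<Sum>k\<in>UNIV. \<bar>\<nu> $ k\<bar>)" by (rule member_le_sum) auto
      also have "\<dots> \<le> (\<Sum>\<nu>\<in>S. \<Sum>k\<in>UNIV. \<bar>\<nu> $ k\<bar>)"
        using that S by (intro member_le_sum) (auto intro: sum_nonneg)
      finally show ?thesis using N by (simp add: N0_def)
    qed
    let ?Z = "{\<zeta>::'k^'d. \<forall>i. \<zeta> $ i \<in> roots_of_unity N}"
    have nz: "\<zeta> $ k \<noteq> 0" if "\<zeta> \<in> ?Z" for \<zeta> k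
    proof
      assume "\<zeta> $ k = 0"
      moreover have "(\<zeta> $ k) ^ N = 1" using that by (auto simp: roots_of_unity_def)
      ultimately show False using N by (simp add: power_0_left)
    qed
    have "(\<Sum>\<zeta>\<in>?Z. G \<zeta>) = (\<Sum>\<zeta>\<in>?Z. \<Sum>\<nu>\<in>S. c \<nu> * lmonom \<zeta> \<nu>)"
      by (intro sum.cong refl G nz)
    also have "\<dots> = (\<Sum>\<nu>\<in>S. c \<nu> * (\<Sum>\<zeta>\<in>?Z. lmonom \<zeta> \<nu>))"
      by (subst sum.swap) (simp add: sum_distrib_left)
    also have "\<dots> = (\<Sum>\<nu>\<in>S. if \<nu> = 0 then of_nat N ^ CARD('d) * c 0 else 0)"
    proof (intro sum.cong refl)
      fix \<nu> assume \<nu>: "\<nu> \<in> S"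
      have "(\<Sum>\<zeta>\<in>?Z. lmonom \<zeta> \<nu>) = (\<Prod>k\<in>UNIV. \<Sum>x\<in>roots_of_unity N. x powi (\<nu> $ k))"
        unfolding lmonom_def using N by (intro sum_prod_vec finite_roots_of_unity)
      also have "\<dots> = (\<Prod>k\<in>(UNIV::'d set). if \<nu> $ k = 0 then of_nat N else 0)"
        using N small[OF \<nu>] by (intro prod.cong refl sum_powi_roots_of_unity) auto
      also have "\<dots> = (if \<nu> = 0 then of_nat N ^ CARD('d) else 0)"
        by (auto simp: vec_eq_iff)
      finally show "c \<nu> * (\<Sum>\<zeta>\<in>?Z. lmonom \<zeta> \<nu>) = (if \<nu> = 0 then of_nat N ^ CARD('d) * c 0 else 0)"
        by simp
    qed
    also have "\<dots> = of_nat N ^ CARD('d) * C" using S by (simp add: C_def)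
    finally show "(1 / of_nat N ^ CARD('d)) * (\<Sum>\<zeta>\<in>?Z. G \<zeta>) = C" using N by simp
  qed
qed

end

section \<open>Existence of the Snirelman integral\<close>

locale complex_padic =
  fixes p :: nat and nv :: "'k::field_char_0 \<Rightarrow> real"
  assumes Cp: "is_Cp p nv"
begin

sublocale alg_closed_nonarch_field nv
  using Cp unfolding is_Cp_def by unfold_locales auto

lemma prime_p: "prime p"
  using Cp by (simp add: is_Cp_def)

lemma nv_complete: "nv_cauchy nv X \<Longrightarrow> \<exists>L. nv_limit nv X L"
  using Cp by (simp add: is_Cp_def)

lemma nv_of_nat:
  assumes "k > 0"
  shows "nv (of_nat k) = real p powr - real (multiplicity (int p) (int k))"
proof -
  have "nv (of_nat k) = padic_abs_rat p (of_nat k)"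
    using Cp unfolding is_Cp_def by (metis of_rat_of_nat_eq)
  moreover have "quotient_of (of_nat k) = (int k, 1)"
    using quotient_of_int[of "int k"] by simp
  ultimately show ?thesis using assms by (simp add: padic_abs_rat_def)
qed

lemma nv_of_nat_coprime:
  assumes "coprime N p"
  shows "nv (of_nat N) = 1"
proof -
  have "\<not> p dvd N"
    using assms prime_p by (metis coprime_absorb_right not_prime_unit)
  then have "multiplicity (int p) (int N) = 0"
    by (intro not_dvd_imp_multiplicity_0) simp
  moreover have "N > 0" using \<open>\<not> p dvd N\<close> by (cases N) auto
  ultimately show ?thesis using nv_of_nat[of N] prime_gt_0_nat[OF prime_p] by simp
qed

text \<open>The power of \<open>p\<close> dividing \<open>k\<close> is at most \<open>k\<close>.
  This linear bound controls the denominators of the logarithm series.\<close>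

lemma nv_inverse_of_nat_le:
  assumes "k > 0"
  shows "nv (1 / of_nat k) \<le> real k"
proof -
  let ?m = "multiplicity (int p) (int k)"
  have p0: "real p > 0" using prime_gt_0_nat[OF prime_p] by simp
  have "int p ^ ?m dvd int k" by (rule multiplicity_dvd)
  then have "p ^ ?m dvd k" by (metis of_nat_dvd_iff of_nat_power)
  then have le: "p ^ ?m \<le> k" using assms by (rule dvd_imp_le)
  have "nv (1 / of_nat k) = real p powr real ?m"
    using assms unfolding nv_divide nv_of_nat[OF assms] powr_minus by (simp add: inverse_eq_divide)
  also have "\<dots> = real (p ^ ?m)" using p0 by (simp add: powr_realpow)
  finally show ?thesis using le by (simp only: of_nat_le_iff)
qed

definition avg :: "nat \<Rightarrow> ('k^'d::finite \<Rightarrow> 'k) \<Rightarrow> 'k" where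
  "avg N F = (1 / of_nat N ^ CARD('d)) * (\<Sum>\<zeta>\<in>{\<zeta>::'k^'d. \<forall>i. \<zeta> $ i \<in> roots_of_unity N}. F \<zeta>)"

lemma torsion_in_torus:
  fixes \<zeta> :: "'k^'d::finite"
  assumes "N > 0" "\<forall>i. \<zeta> $ i \<in> roots_of_unity N"
  shows "\<zeta> \<in> torus_p nv"
  using assms by (auto simp: torus_p_def roots_of_unity_def intro: root_of_unity_nv)

text \<open>For \<open>N\<close> prime to \<open>p\<close> the factor 1/N^d has absolute value 1, so
  by the ultrametric inequality averaging cannot enlarge a uniform bound on the torus.\<close>

lemma avg_diff_less:
  fixes F G :: "'k^'d::finite \<Rightarrow> 'k"
  assumes N: "coprime N p" and e: "e > 0" and FG: "\<And>z. z \<in> torus_p nv \<Longrightarrow> nv (F z - G z) < e"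
  shows "nv (avg N F - avg N G) < e"
proof -
  have N0: "N > 0" using N prime_p by (cases N) auto
  have "avg N F - avg N G = (1 / of_nat N ^ CARD('d)) *
      (\<Sum>\<zeta>\<in>{\<zeta>::'k^'d. \<forall>i. \<zeta> $ i \<in> roots_of_unity N}. F \<zeta> - G \<zeta>)"
    by (simp add: avg_def right_diff_distrib sum_subtractf)
  then have "nv (avg N F - avg N G) = nv (1 / of_nat N ^ CARD('d)) *
      nv (\<Sum>\<zeta>\<in>{\<zeta>::'k^'d. \<forall>i. \<zeta> $ i \<in> roots_of_unity N}. F \<zeta> - G \<zeta>)"
    by (simp only: nv_mult)
  moreover have "nv (1 / of_nat N ^ CARD('d)) = 1"
    using nv_of_nat_coprime[OF N] by (simp add: nv_divide nv_power)
  moreover have "nv (\<Sum>\<zeta>\<in>{\<zeta>::'k^'d. \<forall>i. \<zeta> $ i \<in> roots_of_unity N}. F \<zeta> - G \<zeta>) < e"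
    using FG torsion_in_torus[OF N0] e by (intro nv_sum_less) auto
  ultimately show ?thesis by simp
qed

text \<open>The averages of each approximant are eventually constant by
  \<open>laurent_average\<close>. By \<open>avg_diff_less\<close> these constants form a Cauchy
  sequence, and its limit is the integral.\<close>

lemma snirelman_uniform_limit:
  fixes F :: "'k^'d::finite \<Rightarrow> 'k"
  assumes "\<And>e. e > 0 \<Longrightarrow> \<exists>G. laurent_fun G \<and> (\<forall>z\<in>torus_p nv. nv (F z - G z) < e)"
  shows "\<exists>I. snirelman_integral_is p nv F I"
proof -
  define \<epsilon> :: "nat \<Rightarrow> real" where "\<epsilon> = (\<lambda>K. 1 / real (Suc K))"
  have \<epsilon>: "\<epsilon> K > 0" for K by (simp add: \<epsilon>_def)
  have \<epsilon>_mono: "\<epsilon> L \<le> \<epsilon> K" if "K \<le> L" for K L using that by (simp add: \<epsilon>_def field_simps)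
  have "\<forall>K. \<exists>G. laurent_fun G \<and> (\<forall>z\<in>torus_p nv. nv (F z - G z) < \<epsilon> K)"
    using assms \<epsilon> by blast
  from choice[OF this] obtain G where
    G: "\<And>K. laurent_fun (G K)" "\<And>K z. z \<in> torus_p nv \<Longrightarrow> nv (F z - G K z) < \<epsilon> K"
    by blast
  have "\<forall>K. \<exists>q. \<forall>N\<ge>snd q. N > 0 \<longrightarrow> avg N (G K) = fst q"
    using laurent_average[OF G(1)] unfolding avg_def by auto
  from choice[OF this] obtain q where
    q: "\<And>K N. N \<ge> snd (q K) \<Longrightarrow> N > 0 \<Longrightarrow> avg N (G K) = fst (q K)"
    by blast
  define C N0 where "C = fst \<circ> q" and "N0 = snd \<circ> q"
  have C: "avg N (G K) = C K" if "N \<ge> N0 K" "N > 0" for N K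
    using q that by (simp add: C_def N0_def)
  have FC: "nv (avg N F - C K) < \<epsilon> K" if "N \<ge> N0 K" "coprime N p" for N K
  proof -
    have "N > 0" using that prime_p by (cases N) auto
    then show ?thesis using avg_diff_less[of N "\<epsilon> K" F "G K", OF that(2) \<epsilon> G(2)] C[OF that(1)] by simp
  qed
  have near: "nv (C K - C L) < \<epsilon> M" if "M \<le> K" "M \<le> L" for K L M
  proof -
    \<comment> \<open>\<open>N\<close> is past both thresholds and prime to \<open>p\<close>, so a
      single average of \<open>F\<close> is close to both constants.\<close>
    define T where "T = N0 K + N0 L"
    define N where "N = p * T + 1"
    have "T \<le> p * T" using prime_gt_0_nat[OF prime_p] by (cases p) auto
    then have "T \<le> N" unfolding N_def by (rule trans_le_add1)
    then have N: "N \<ge> N0 K" "N \<ge> N0 L" by (simp_all add: T_def)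
    have "coprime (Suc (p * T)) (p * T)" by (rule coprime_Suc_left_nat)
    then have "coprime N p" unfolding coprime_mult_right_iff N_def Suc_eq_plus1 by (rule conjunct1)
    have "nv (avg N F - C K) < \<epsilon> M"
      by (rule order.strict_trans2[OF FC[OF N(1) \<open>coprime N p\<close>] \<epsilon>_mono[OF that(1)]])
    moreover have 2: "nv (avg N F - C L) < \<epsilon> M"
      by (rule order.strict_trans2[OF FC[OF N(2) \<open>coprime N p\<close>] \<epsilon>_mono[OF that(2)]])
    ultimately have "nv (C K - avg N F) < \<epsilon> M" by (subst nv_diff_commute)
    from this 2 show ?thesis by (rule nv_diff_triangle_less)
  qed
  have small: "\<exists>K. \<epsilon> K < e" if "e > 0" for e
    using reals_Archimedean[OF that] by (simp add: \<epsilon>_def inverse_eq_divide)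
  have "nv_cauchy nv C"
    unfolding nv_cauchy_def
  proof (intro allI impI)
    fix e :: real assume "e > 0"
    then obtain M where "\<epsilon> M < e" using small[of e] by auto
    have "\<forall>K\<ge>M. \<forall>L\<ge>M. nv (C K - C L) < e"
      by (intro allI impI order.strict_trans[OF near \<open>\<epsilon> M < e\<close>])
    then show "\<exists>M. \<forall>K\<ge>M. \<forall>L\<ge>M. nv (C K - C L) < e" ..
  qed
  then obtain I where I: "nv_limit nv C I" using nv_complete by blast
  have "snirelman_integral_is p nv F I"
    unfolding snirelman_integral_is_def avg_def[symmetric]
  proof (intro allI impI)
    fix e :: real assume e: "e > 0"
    obtain K0 where K0: "\<epsilon> K0 < e" using small[OF e] by blast
    obtain K1 where K1: "\<And>K. K \<ge> K1 \<Longrightarrow> nv (C K - I) < e" using I e unfolding nv_limit_def by blast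
    define K where "K = max K0 K1"
    have "nv (avg N F - I) < e" if "N \<ge> N0 K" "coprime N p" for N
    proof (rule nv_diff_triangle_less)
      show "nv (avg N F - C K) < e" using FC[OF that] \<epsilon>_mono[of K0 K] K0 by (simp add: K_def)
      show "nv (C K - I) < e" by (rule K1) (simp add: K_def)
    qed
    then show "\<exists>N0. \<forall>N\<ge>N0. coprime N p \<longrightarrow> nv (avg N F - I) < e" by blast
  qed
  then show ?thesis ..
qed

text \<open>Snirelman sums see only torsion points of the torus. This permits a change of integrand
  that is justified only there.\<close>

lemma snirelman_integral_cong:
  fixes F G :: "'k^'d::finite \<Rightarrow> 'k"
  assumes "\<And>N z. N > 0 \<Longrightarrow> \<forall>i. z $ i \<in> roots_of_unity N \<Longrightarrow> F z = G z"
    and "snirelman_integral_is p nv F I"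
  shows "snirelman_integral_is p nv G I"
proof -
  have "avg N F = avg N G" if "coprime N p" for N
  proof -
    have "N > 0" using that prime_p by (cases N) auto
    then show ?thesis unfolding avg_def using assms(1) by (intro arg_cong2[where f="(*)"] sum.cong) auto
  qed
  then show ?thesis using assms(2) unfolding snirelman_integral_is_def avg_def[symmetric] by metis
qed

end

section \<open>The Iwasawa logarithm of a Laurent polynomial without zeros on the torus\<close>

locale iwasawa_log = complex_padic p nv
  for p :: nat and nv :: "'k::field_char_0 \<Rightarrow> real" +
  fixes lg :: "'k \<Rightarrow> 'k"
  assumes log: "is_log_p p nv lg"
begin

lemma lg_mult: "x \<noteq> 0 \<Longrightarrow> y \<noteq> 0 \<Longrightarrow> lg (x * y) = lg x + lg y"
  using log by (simp add: is_log_p_def)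

lemma lg_1 [simp]: "lg 1 = 0"
  using lg_mult[of 1 1] by simp

lemma lg_power: "x \<noteq> 0 \<Longrightarrow> lg (x ^ n) = of_nat n * lg x"
  by (induction n) (simp_all add: lg_mult algebra_simps)

lemma lg_prod: "(\<And>i. i \<in> A \<Longrightarrow> f i \<noteq> 0) \<Longrightarrow> lg (\<Prod>i\<in>A. f i) = (\<Sum>i\<in>A. lg (f i))"
  by (induction A rule: infinite_finite_induct) (auto simp: lg_mult)

text \<open>\<open>lg\<close> is a homomorphism into an additive group which, in characteristic 0,
  has no torsion.\<close>

lemma lg_root_of_unity:
  assumes "x ^ N = 1" "N > 0"
  shows "lg x = 0"
proof -
  have "x \<noteq> 0" using assms by (auto simp: power_0_left)
  then have "of_nat N * lg x = 0" using lg_power[of x N] assms by simp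
  then show ?thesis using assms by simp
qed

lemma lg_minus: "x \<noteq> 0 \<Longrightarrow> lg (- x) = lg x"
  using lg_mult[of "-1" x] lg_root_of_unity[of "-1" 2] by simp

text \<open>Since -1 is a root of unity, \<open>lg\<close> ignores signs. A point count given as an
  absolute determinant can thus be replaced by the determinant itself.\<close>

lemma lg_of_nat_abs: "m \<noteq> 0 \<Longrightarrow> lg (of_nat (nat \<bar>m\<bar>)) = lg (of_int m)"
  using lg_minus[of "of_int m"] by (cases "m \<ge> 0") auto

text \<open>On the torus the i-th term of the series at \<open>h z\<close> is at most i \<delta>^i,
  which tends to 0, and a finite block of terms is no larger than its largest term. Partial sums
  therefore approximate uniformly in \<open>z\<close>.\<close>

lemma lg_uniform_limit:
  assumes h: "laurent_fun h" and \<delta>: "0 \<le> \<delta>" "\<delta> < 1"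
    and h\<delta>: "\<And>z. z \<in> torus_p nv \<Longrightarrow> nv (h z) \<le> \<delta>" and e: "e > 0"
  shows "\<exists>G. laurent_fun G \<and> (\<forall>z\<in>torus_p nv. nv (lg (1 + h z) - G z) < e)"
proof -
  define s where "s = (\<lambda>K x. \<Sum>n\<in>{1..K}. (-1) ^ (n + 1) * x ^ n / (of_nat n :: 'k))"
  have "(\<lambda>n. real n * \<delta> ^ n) \<longlonglongrightarrow> 0"
    using powser_times_n_limit_0[of \<delta>] \<delta> by simp
  then obtain K where K: "\<And>n. n \<ge> K \<Longrightarrow> real n * \<delta> ^ n < e"
    using LIMSEQ_D[OF _ e, of "\<lambda>n. real n * \<delta> ^ n" 0] \<delta> by auto
  have "nv (lg (1 + h z) - s K (h z)) < e" if z: "z \<in> torus_p nv" for z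
  proof -
    have "nv (h z) < 1" using h\<delta>[OF z] \<delta> by simp
    then have "nv_limit nv (\<lambda>N. s N (h z)) (lg (1 + h z))"
      using log unfolding is_log_p_def s_def by blast
    then obtain M where M: "\<And>n. n \<ge> M \<Longrightarrow> nv (s n (h z) - lg (1 + h z)) < e"
      using e unfolding nv_limit_def by blast
    \<comment> \<open>\<open>K\<close> is uniform in \<open>z\<close> while \<open>M\<close> depends
      on it; the detour through the partial sum up to \<open>n\<close> keeps \<open>M\<close> out of
      the approximant.\<close>
    define n where "n = max M K"
    have summand: "nv ((-1) ^ (i + 1) * h z ^ i / of_nat i) < e" if i: "i \<in> {K<..n}" for i
    proof -
      have "nv ((-1) ^ (i + 1) * h z ^ i / of_nat i) = nv (h z) ^ i * nv (1 / of_nat i)"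
        by (simp add: nv_mult nv_power nv_divide)
      also have "\<dots> \<le> \<delta> ^ i * real i"
        using h\<delta>[OF z] i \<delta> by (intro mult_mono power_mono nv_inverse_of_nat_le) auto
      also have "\<dots> < e" using K[of i] i by (simp add: mult.commute)
      finally show ?thesis .
    qed
    have "{1..n} = {1..K} \<union> {K<..n}" by (auto simp: n_def)
    then have "s n (h z) = s K (h z) + (\<Sum>i\<in>{K<..n}. (-1) ^ (i + 1) * h z ^ i / of_nat i)"
      unfolding s_def by (simp only: sum.union_disjoint[of "{1..K}" "{K<..n}"] finite_atLeastAtMost
        finite_greaterThanAtMost ivl_disj_int)
    then have "nv (s n (h z) - s K (h z)) < e" using nv_sum_less[OF summand e, of "{K<..n}" "\<lambda>i. i"] by simp
    moreover have "nv (lg (1 + h z) - s n (h z)) < e"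
      using M[of n] by (simp add: n_def nv_diff_commute[of "lg (1 + h z)"])
    ultimately show ?thesis by (rule nv_diff_triangle_less[rotated])
  qed
  moreover have "laurent_fun (\<lambda>z. s K (h z))"
  proof -
    have "laurent_fun (\<lambda>z. \<Sum>n\<in>{1..K}. ((-1) ^ (n + 1) / of_nat n) * h z ^ n)"
      by (intro laurent_fun_sum laurent_fun_mult laurent_fun_const laurent_fun_power h)
    then show ?thesis by (simp add: s_def)
  qed
  ultimately show ?thesis by blast
qed

text \<open>Factoring out the dominant term leaves \<open>1 + h\<close> with \<open>h\<close>
  uniformly small, to which \<open>lg_uniform_limit\<close> applies.\<close>

lemma snirelman_lg_laurent:
  fixes F :: "'k^'d::finite \<Rightarrow> 'k"
  assumes F: "laurent_fun F" and nz: "\<And>z. z \<in> torus_p nv \<Longrightarrow> F z \<noteq> 0"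
  shows "\<exists>I. snirelman_integral_is p nv (\<lambda>z. lg (F z)) I"
proof -
  have t0: "z $ k \<noteq> 0" if "z \<in> torus_p nv" for z :: "'k^'d" and k
  proof
    assume "z $ k = 0"
    moreover have "nv (z $ k) = 1" using that by (simp add: torus_p_def)
    ultimately show False by simp
  qed
  obtain S c where S: "finite S" and FS: "\<And>z. (\<And>k. z $ k \<noteq> 0) \<Longrightarrow> F z = (\<Sum>\<nu>\<in>S. c \<nu> * lmonom z \<nu>)"
    using F unfolding laurent_fun_def by blast
  have FT: "F z = (\<Sum>\<nu>\<in>S. c \<nu> * lmonom z \<nu>)" if "z \<in> torus_p nv" for z
    using FS t0[OF that] by blast
  obtain \<kappa> where \<kappa>: "\<kappa> \<in> S" "c \<kappa> \<noteq> 0" and dom: "\<And>\<mu>. \<mu> \<in> S - {\<kappa>} \<Longrightarrow> nv (c \<mu>) < nv (c \<kappa>)"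
    using laurent_dominant_term[OF S FT nz] by blast
  define h where "h = (\<lambda>z. \<Sum>\<mu>\<in>S - {\<kappa>}. c \<mu> / c \<kappa> * lmonom z (\<mu> - \<kappa>))"
  \<comment> \<open>The inserted 0 keeps the maximum defined when \<open>S\<close> has only one
    element.\<close>
  define \<delta> where "\<delta> = Max (insert 0 ((\<lambda>\<mu>. nv (c \<mu> / c \<kappa>)) ` (S - {\<kappa>})))"
  have \<delta>: "0 \<le> \<delta>" "\<delta> < 1" using S dom \<kappa> by (auto simp: \<delta>_def nv_divide)
  have lm: "nv (lmonom z \<mu>) = 1" if "z \<in> torus_p nv" for z :: "'k^'d" and \<mu>
    using that by (simp add: lmonom_def nv_prod nv_power_int torus_p_def)
  have h\<delta>: "nv (h z) \<le> \<delta>" if "z \<in> torus_p nv" for z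
    unfolding h_def
  proof (rule nv_sum_le[OF _ \<delta>(1)])
    fix \<mu> assume "\<mu> \<in> S - {\<kappa>}"
    then have "nv (c \<mu> / c \<kappa>) \<le> \<delta>" unfolding \<delta>_def using S by (intro Max_ge) auto
    then show "nv (c \<mu> / c \<kappa> * lmonom z (\<mu> - \<kappa>)) \<le> \<delta>"
      unfolding nv_mult lm[OF that] by simp
  qed
  have split: "F z = c \<kappa> * lmonom z \<kappa> * (1 + h z)" if z: "z \<in> torus_p nv" for z
  proof -
    have "c \<kappa> * lmonom z \<kappa> * (c \<mu> / c \<kappa> * lmonom z (\<mu> - \<kappa>)) = c \<mu> * lmonom z \<mu>" for \<mu>
    proof -
      have "lmonom z \<mu> = lmonom z \<kappa> * lmonom z (\<mu> - \<kappa>)"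
        using lmonom_add[OF t0[OF z], of \<kappa> "\<mu> - \<kappa>"] by simp
      then show ?thesis using \<kappa> by simp
    qed
    then have "c \<kappa> * lmonom z \<kappa> * h z = (\<Sum>\<mu>\<in>S - {\<kappa>}. c \<mu> * lmonom z \<mu>)"
      by (simp add: h_def sum_distrib_left)
    then show ?thesis using FT[OF z] \<kappa> S by (simp add: distrib_left sum.remove)
  qed
  have hl: "laurent_fun h"
    unfolding h_def by (intro laurent_fun_sum laurent_fun_mult laurent_fun_const laurent_fun_lmonom)
  have app: "\<exists>G. laurent_fun G \<and> (\<forall>z\<in>torus_p nv. nv (lg (1 + h z) - G z) < e)" if "e > 0" for e
    by (rule lg_uniform_limit[OF hl \<delta> _ that]) (rule h\<delta>)
  \<comment> \<open>The monomial is left out of the integrand: its logarithm vanishes at roots of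
    unity, the only points that enter the sums.\<close>
  have "\<exists>I. snirelman_integral_is p nv (\<lambda>z. lg (c \<kappa>) + lg (1 + h z)) I"
  proof (rule snirelman_uniform_limit)
    fix e :: real assume "e > 0"
    then obtain G where G: "laurent_fun G" "\<forall>z\<in>torus_p nv. nv (lg (1 + h z) - G z) < e"
      using app by blast
    show "\<exists>G. laurent_fun G \<and> (\<forall>z\<in>torus_p nv. nv (lg (c \<kappa>) + lg (1 + h z) - G z) < e)"
      using G by (intro exI[of _ "\<lambda>z. lg (c \<kappa>) + G z"])
        (auto intro!: laurent_fun_add laurent_fun_const)
  qed
  then obtain I where I: "snirelman_integral_is p nv (\<lambda>z. lg (c \<kappa>) + lg (1 + h z)) I" ..
  have "snirelman_integral_is p nv (\<lambda>z. lg (F z)) I"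
  proof (rule snirelman_integral_cong[OF _ I])
    fix N :: nat and z :: "'k^'d" assume N: "N > 0" and z: "\<forall>i. z $ i \<in> roots_of_unity N"
    have zT: "z \<in> torus_p nv" by (rule torsion_in_torus[OF N z])
    \<comment> \<open>This shows that a monomial evaluated at N-th roots of unity is again an N-th
      root of unity.\<close>
    have "(x powi k) ^ N = (x ^ N) powi k" for x :: 'k and k
      by (simp add: power_int_def power_inverse mult.commute flip: power_mult)
    then have "lmonom z \<kappa> ^ N = (\<Prod>k\<in>UNIV. ((z $ k) ^ N) powi (\<kappa> $ k))"
      by (simp add: lmonom_def prod_power_distrib)
    also have "\<dots> = 1" using z by (simp add: roots_of_unity_def)
    finally have 1: "lg (lmonom z \<kappa>) = 0" using N by (rule lg_root_of_unity)
    have "lmonom z \<kappa> \<noteq> 0" "1 + h z \<noteq> 0" using nz[OF zT] split[OF zT] by auto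
    then show "lg (c \<kappa>) + lg (1 + h z) = lg (F z)"
      using \<kappa> 1 by (simp add: split[OF zT] lg_mult)
  qed
  then show ?thesis ..
qed

end

section \<open>Periodic points\<close>

text \<open>A set of representatives for Z^d modulo (nZ)^d; \<open>vmod\<close> is the projection
  onto it.\<close>

definition period_box :: "nat \<Rightarrow> (int^'d::finite) set" where
  "period_box n = {\<mu>. \<forall>k. \<mu> $ k \<in> {0..<int n}}"

definition vmod :: "int^'d::finite \<Rightarrow> nat \<Rightarrow> int^'d" where
  "vmod \<mu> n = (\<chi> k. \<mu> $ k mod int n)"

lemma finite_period_box: "finite (period_box n)"
  unfolding period_box_def by (rule finite_vec_set) simp

lemma card_period_box: "card (period_box n :: (int^'d::finite) set) = n ^ CARD('d)"
  unfolding period_box_def by (subst card_vec_set) auto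

lemma vmod_in_period_box: "n > 0 \<Longrightarrow> vmod \<mu> n \<in> period_box n"
  by (simp add: vmod_def period_box_def)

lemma vmod_id: "\<mu> \<in> period_box n \<Longrightarrow> vmod \<mu> n = \<mu>"
  by (auto simp: vmod_def period_box_def vec_eq_iff)

lemma vmod_add_left: "vmod (vmod \<mu> n + \<nu>) n = vmod (\<mu> + \<nu>) n"
  by (simp add: vmod_def vec_eq_iff mod_add_left_eq)

lemma diff_vmod_in_Gamma_n: "\<mu> - vmod \<mu> n \<in> Gamma_n n"
  by (simp add: Gamma_n_def vmod_def minus_mod_eq_mult_div)

lemma vmod_diff_Gamma_n: "l \<in> Gamma_n n \<Longrightarrow> vmod (\<mu> - l) n = vmod \<mu> n"
  by (auto simp: Gamma_n_def vmod_def vec_eq_iff mod_eq_dvd_iff)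

text \<open>The block circulant matrix by which \<open>f\<close> acts on \<open>n\<close>-periodic configurations.\<close>

definition period_matrix :: "(int^'d::finite \<Rightarrow> int^'r::finite^'r) \<Rightarrow> nat \<Rightarrow> ((int^'d) \<times> 'r) \<Rightarrow> ((int^'d) \<times> 'r) \<Rightarrow> int" where
  "period_matrix a n = (\<lambda>(l, j) (\<mu>, i). \<Sum>\<nu>\<in>{\<nu>. a \<nu> \<noteq> 0}. if vmod (l + \<nu>) n = \<mu> then a \<nu> $ j $ i else 0)"

text \<open>Resolving the Kronecker deltas turns a row of the matrix into a convolution with the
  coefficients of f. The ring is general because \<open>y\<close> is first a real configuration and
  later a character with values in \<open>'k\<close>.\<close>

lemma period_matrix_sum:
  fixes y :: "(int^'d::finite) \<times> 'r::finite \<Rightarrow> 'b::comm_ring_1"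
  assumes n: "n > 0"
  shows "(\<Sum>q\<in>period_box n \<times> UNIV. of_int (period_matrix a n (vmod l n, j) q) * y q) =
    (\<Sum>\<nu>\<in>{\<nu>. a \<nu> \<noteq> 0}. \<Sum>i\<in>UNIV. of_int (a \<nu> $ j $ i) * y (vmod (l + \<nu>) n, i))"
proof -
  have "(\<Sum>q\<in>period_box n \<times> UNIV. of_int (period_matrix a n (vmod l n, j) q) * y q) =
     (\<Sum>\<mu>\<in>period_box n. \<Sum>i\<in>UNIV. \<Sum>\<nu>\<in>{\<nu>. a \<nu> \<noteq> 0}. (if vmod (l + \<nu>) n = \<mu> then of_int (a \<nu> $ j $ i) * y (\<mu>, i) else 0))"
    by (simp add: sum.cartesian_product' period_matrix_def vmod_add_left sum_distrib_right if_distrib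
        if_distribR cong: if_cong)
  also have "\<dots> = (\<Sum>\<mu>\<in>period_box n. \<Sum>\<nu>\<in>{\<nu>. a \<nu> \<noteq> 0}. \<Sum>i\<in>UNIV. (if vmod (l + \<nu>) n = \<mu> then of_int (a \<nu> $ j $ i) * y (\<mu>, i) else 0))"
    by (intro sum.cong refl sum.swap)
  also have "\<dots> = (\<Sum>\<nu>\<in>{\<nu>. a \<nu> \<noteq> 0}. \<Sum>\<mu>\<in>period_box n. \<Sum>i\<in>UNIV. (if vmod (l + \<nu>) n = \<mu> then of_int (a \<nu> $ j $ i) * y (\<mu>, i) else 0))"
    by (rule sum.swap)
  also have "\<dots> = (\<Sum>\<nu>\<in>{\<nu>. a \<nu> \<noteq> 0}. \<Sum>i\<in>UNIV. \<Sum>\<mu>\<in>period_box n. (if vmod (l + \<nu>) n = \<mu> then of_int (a \<nu> $ j $ i) * y (\<mu>, i) else 0))"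
    by (intro sum.cong refl sum.swap)
  also have "\<dots> = (\<Sum>\<nu>\<in>{\<nu>. a \<nu> \<noteq> 0}. \<Sum>i\<in>UNIV. of_int (a \<nu> $ j $ i) * y (vmod (l + \<nu>) n, i))"
    by (intro sum.cong refl) (simp add: sum.delta' finite_period_box vmod_in_period_box[OF n])
  finally show ?thesis .
qed

text \<open>The substitution \<mu> = l + \<nu> gives the defining relation of \<open>X_f\<close> the
  convolution form of \<open>period_matrix_sum\<close>, the transpose being absorbed into the order
  of indices.\<close>

lemma X_f_sum_shift:
  fixes x :: "int^'d::finite \<Rightarrow> real^'r::finite"
  shows "(\<Sum>\<mu>\<in>{\<mu>. a (\<mu> - l) \<noteq> 0}. \<Sum>i\<in>UNIV. x \<mu> $ i * of_int (transpose (a (\<mu> - l)) $ i $ j)) =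
     (\<Sum>\<nu>\<in>{\<nu>. a \<nu> \<noteq> 0}. \<Sum>i\<in>UNIV. of_int (a \<nu> $ j $ i) * x (l + \<nu>) $ i)"
  by (rule sum.reindex_bij_witness[where i="\<lambda>\<nu>. l + \<nu>" and j="\<lambda>\<mu>. \<mu> - l"])
     (auto simp: transpose_def mult.commute)

lemma Fix_Gamma_periodic:
  assumes "x \<in> Fix_Gamma (Gamma_n n) X"
  shows "x (vmod \<mu> n) = x \<mu>"
proof -
  have "(\<lambda>\<kappa>. x (\<kappa> - (\<mu> - vmod \<mu> n))) = x"
    using assms diff_vmod_in_Gamma_n by (auto simp: Fix_Gamma_def)
  then show ?thesis by (auto dest: fun_cong[of _ _ \<mu>])
qed

text \<open>Restriction to the period box and periodic extension are mutually inverse. For periodic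
  configurations the relation at \<open>l\<close> depends only on \<open>vmod l n\<close>, so the
  relations indexed by the box suffice.\<close>

lemma bij_betw_Fix_Gamma_box_solutions:
  fixes a :: "int^'d::finite \<Rightarrow> int^'r::finite^'r"
  assumes n: "n > 0"
  shows "bij_betw (\<lambda>x. \<lambda>q\<in>period_box n \<times> UNIV. x (fst q) $ snd q) (Fix_Gamma (Gamma_n n) (X_f a))
     (box_solutions (period_box n \<times> UNIV) (period_matrix a n))"
proof (rule bij_betw_byWitness[where f'="\<lambda>y \<mu>. \<chi> i. y (vmod \<mu> n, i)"])
  have sum: "(\<Sum>q\<in>period_box n \<times> UNIV. of_int (period_matrix a n (l, j) q) * y q) =
    (\<Sum>\<nu>\<in>{\<nu>. a \<nu> \<noteq> 0}. \<Sum>i\<in>UNIV. of_int (a \<nu> $ j $ i) * y (vmod (l + \<nu>) n, i))"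
    if "l \<in> period_box n" for l j and y :: "(int^'d) \<times> 'r \<Rightarrow> real"
    using period_matrix_sum[OF n, of a l j y] vmod_id[OF that] by simp
  show "\<forall>x\<in>Fix_Gamma (Gamma_n n) (X_f a).
      (\<lambda>\<mu>. \<chi> i. (\<lambda>q\<in>period_box n \<times> UNIV. x (fst q) $ snd q) (vmod \<mu> n, i)) = x"
    by (auto simp: fun_eq_iff vec_eq_iff vmod_in_period_box[OF n] Fix_Gamma_periodic)
  show "\<forall>y\<in>box_solutions (period_box n \<times> UNIV) (period_matrix a n).
      (\<lambda>q\<in>period_box n \<times> UNIV. (\<chi> i. y (vmod (fst q) n, i)) $ snd q) = y"
    by (auto simp: box_solutions_def fun_eq_iff vmod_id PiE_iff extensional_def restrict_def)
  show "(\<lambda>x. \<lambda>q\<in>period_box n \<times> UNIV. x (fst q) $ snd q) ` Fix_Gamma (Gamma_n n) (X_f a)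
      \<subseteq> box_solutions (period_box n \<times> UNIV) (period_matrix a n)"
  proof (rule image_subsetI)
    fix x assume x: "x \<in> Fix_Gamma (Gamma_n n) (X_f a)"
    let ?y = "\<lambda>q\<in>period_box n \<times> UNIV. x (fst q) $ snd q"
    have xX: "x \<in> X_f a" using x by (simp add: Fix_Gamma_def)
    have "(\<Sum>q\<in>period_box n \<times> UNIV. of_int (period_matrix a n (l, j) q) * ?y q) \<in> \<int>" if "l \<in> period_box n" for l j
    proof -
      have "(\<Sum>q\<in>period_box n \<times> UNIV. of_int (period_matrix a n (l, j) q) * ?y q) =
        (\<Sum>\<nu>\<in>{\<nu>. a \<nu> \<noteq> 0}. \<Sum>i\<in>UNIV. of_int (a \<nu> $ j $ i) * x (l + \<nu>) $ i)"
        unfolding sum[OF that] by (simp add: vmod_in_period_box[OF n] Fix_Gamma_periodic[OF x])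
      then show ?thesis using xX by (simp add: X_f_def X_f_sum_shift)
    qed
    moreover have "?y \<in> period_box n \<times> UNIV \<rightarrow>\<^sub>E {0..<1}" using xX by (auto simp: X_f_def)
    ultimately show "?y \<in> box_solutions (period_box n \<times> UNIV) (period_matrix a n)"
      by (auto simp: box_solutions_def)
  qed
  show "(\<lambda>y \<mu>. \<chi> i. y (vmod \<mu> n, i)) ` box_solutions (period_box n \<times> UNIV) (period_matrix a n)
      \<subseteq> Fix_Gamma (Gamma_n n) (X_f a)"
  proof (rule image_subsetI)
    fix y assume y: "y \<in> box_solutions (period_box n \<times> UNIV) (period_matrix a n)"
    let ?x = "\<lambda>\<mu>. \<chi> i. y (vmod \<mu> n, i)"
    have "(\<Sum>\<nu>\<in>{\<nu>. a \<nu> \<noteq> 0}. \<Sum>i\<in>UNIV. of_int (a \<nu> $ j $ i) * ?x (l + \<nu>) $ i) \<in> \<int>" for l j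
    proof -
      have "(\<Sum>q\<in>period_box n \<times> UNIV. of_int (period_matrix a n (vmod l n, j) q) * y q) \<in> \<int>"
        using y vmod_in_period_box[OF n, of l] by (auto simp: box_solutions_def)
      then show ?thesis by (simp add: period_matrix_sum[OF n])
    qed
    moreover have "0 \<le> ?x \<mu> $ j \<and> ?x \<mu> $ j < 1" for \<mu> j
      using y vmod_in_period_box[OF n, of \<mu>] by (auto simp: box_solutions_def PiE_iff)
    ultimately have "?x \<in> X_f a" unfolding X_f_def X_f_sum_shift by blast
    then show "?x \<in> Fix_Gamma (Gamma_n n) (X_f a)"
      by (auto simp: Fix_Gamma_def vmod_diff_Gamma_n)
  qed
qed

lemma finite_card_Fix_Gamma:
  fixes a :: "int^'d::finite \<Rightarrow> int^'r::finite^'r"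
  assumes n: "n > 0" and nz: "gdet (period_box n \<times> UNIV) (period_matrix a n) \<noteq> 0"
  shows "finite (Fix_Gamma (Gamma_n n) (X_f a))"
    and "card (Fix_Gamma (Gamma_n n) (X_f a)) = nat \<bar>gdet (period_box n \<times> UNIV) (period_matrix a n)\<bar>"
proof -
  have "finite (period_box n \<times> UNIV :: ((int^'d) \<times> 'r) set)"
    by (rule finite_cartesian_product[OF finite_period_box]) simp
  from card_box_solutions[OF this nz] bij_betw_Fix_Gamma_box_solutions[OF n, of a]
  show "finite (Fix_Gamma (Gamma_n n) (X_f a))"
    and "card (Fix_Gamma (Gamma_n n) (X_f a)) = nat \<bar>gdet (period_box n \<times> UNIV) (period_matrix a n)\<bar>"
    by (simp_all add: bij_betw_finite bij_betw_same_card)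
qed

section \<open>Characters of (Z/n)^d and the determinant of the period matrix\<close>

lemma lmonom_vmod:
  fixes z :: "'a::field^'d::finite"
  assumes "n > 0" "\<forall>k. z $ k \<in> roots_of_unity n"
  shows "lmonom z (vmod \<mu> n) = lmonom z \<mu>"
proof -
  have "w powi (m mod int n) = w powi m" if "w ^ n = 1" for w :: 'a and m
  proof -
    have "w \<noteq> 0" using that assms by (auto simp: power_0_left)
    \<comment> \<open>The multiple of \<open>n\<close> in the exponent contributes a power of
      \<open>w ^ n\<close>, which is 1.\<close>
    have "w powi m = w powi (int n * (m div int n) + m mod int n)" by simp
    also have "\<dots> = (w powi int n) powi (m div int n) * w powi (m mod int n)"
      using \<open>w \<noteq> 0\<close> by (subst power_int_add) (auto simp: power_int_mult)
    finally show ?thesis using that by simp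
  qed
  then show ?thesis using assms by (simp add: lmonom_def vmod_def roots_of_unity_def)
qed

text \<open>Orthogonality of characters: the sum factors over the coordinates into geometric sums of
  n-th roots of unity, each of which vanishes unless the root is 1.\<close>

lemma sum_lmonom_period_box:
  fixes \<zeta> \<xi> :: "'a::field_char_0^'d::finite"
  assumes n: "n > 0" and \<zeta>: "\<forall>k. \<zeta> $ k \<in> roots_of_unity n" and \<xi>: "\<forall>k. \<xi> $ k \<in> roots_of_unity n"
  shows "(\<Sum>\<mu>\<in>period_box n. lmonom \<zeta> (- \<mu>) * lmonom \<xi> \<mu>) = (if \<zeta> = \<xi> then of_nat n ^ CARD('d) else 0)"
proof -
  have geo: "(\<Sum>m\<in>{0..<int n}. w powi m) = (if w = 1 then of_nat n else 0)" if "w ^ n = 1" for w :: 'a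
  proof -
    have "(\<Sum>m\<in>{0..<int n}. w powi m) = (\<Sum>m<n. w ^ m)"
      by (rule sum.reindex_bij_witness[where i=int and j=nat]) (auto simp: power_int_def)
    then show ?thesis using that by (simp add: sum_gp_strict)
  qed
  have "(\<Sum>\<mu>\<in>period_box n. lmonom \<zeta> (- \<mu>) * lmonom \<xi> \<mu>) = (\<Sum>\<mu>\<in>period_box n. \<Prod>k\<in>UNIV. (\<xi> $ k / \<zeta> $ k) powi (\<mu> $ k))"
    by (simp add: lmonom_def power_int_minus power_int_divide_distrib divide_inverse mult.commute
        power_int_mult_distrib power_int_inverse flip: prod.distrib)
  also have "\<dots> = (\<Prod>k\<in>UNIV. \<Sum>m\<in>{0..<int n}. (\<xi> $ k / \<zeta> $ k) powi m)"
    unfolding period_box_def by (rule sum_prod_vec) simp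
  also have "\<dots> = (\<Prod>k\<in>(UNIV::'d set). if \<xi> $ k / \<zeta> $ k = 1 then of_nat n else 0)"
    using \<zeta> \<xi> by (intro prod.cong refl geo) (simp add: roots_of_unity_def power_divide)
  also have "\<dots> = (\<Prod>k\<in>(UNIV::'d set). if \<xi> $ k = \<zeta> $ k then of_nat n else 0)"
  proof (intro prod.cong refl)
    fix k
    have "(\<zeta> $ k) ^ n = 1" using \<zeta> by (simp add: roots_of_unity_def)
    then have "\<zeta> $ k \<noteq> 0" using n by (auto simp: power_0_left)
    then show "(if \<xi> $ k / \<zeta> $ k = 1 then of_nat n else 0) = (if \<xi> $ k = \<zeta> $ k then of_nat n else (0::'a))"
      by simp
  qed
  also have "\<dots> = (if \<zeta> = \<xi> then of_nat n ^ CARD('d) else 0)"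
  proof (cases "\<zeta> = \<xi>")
    case False
    then obtain k where "\<xi> $ k \<noteq> \<zeta> $ k" by (metis vec_eq_iff)
    then show ?thesis using False by (auto intro!: prod_zero)
  qed simp
  finally show ?thesis .
qed

text \<open>The characters, as columns of \<open>\<Phi>\<close>, intertwine the circulant matrix
  with a block diagonal matrix whose blocks are the values of f at points of mu_n^d. Since
  \<open>\<Phi>\<close> has nonzero determinant, the two determinants agree.\<close>

lemma (in alg_closed_nonarch_field) gdet_period_matrix:
  fixes a :: "int^'d::finite \<Rightarrow> int^'r::finite^'r"
  assumes n: "n > 0"
  shows "of_int (gdet (period_box n \<times> UNIV) (period_matrix a n)) =
    (\<Prod>\<zeta>\<in>{\<zeta>::'k^'d. \<forall>k. \<zeta> $ k \<in> roots_of_unity n}. det (laurent_eval a \<zeta>))"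
proof -
  let ?Z = "{\<zeta>::'k^'d. \<forall>k. \<zeta> $ k \<in> roots_of_unity n}"
  let ?I = "period_box n \<times> UNIV :: ((int^'d) \<times> 'r) set"
  have finZ: "finite ?Z" using finite_roots_of_unity[OF n] by (rule finite_vec_set)
  have fin: "finite ?I" by (rule finite_cartesian_product[OF finite_period_box]) simp
  have "card ?Z = n ^ CARD('d)"
    using finite_roots_of_unity[OF n] by (simp add: card_vec_set card_roots_of_unity[OF n])
  then have "card (period_box n :: (int^'d) set) = card ?Z" by (simp add: card_period_box)
  \<comment> \<open>An arbitrary labelling of the characters by box elements makes
    \<open>\<Phi>\<close> a square matrix over the single index set \<open>?I\<close>, as
    \<open>gdet\<close> requires.\<close>
  then obtain b where b: "bij_betw b (period_box n :: (int^'d) set) ?Z"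
    using finite_same_card_bij[OF finite_period_box finZ] by blast
  have bZ: "\<forall>k. b \<kappa> $ k \<in> roots_of_unity n" if "\<kappa> \<in> period_box n" for \<kappa>
    using bij_betwE[OF b] that by blast
  have b_eq: "b \<kappa> = b \<tau> \<longleftrightarrow> \<kappa> = \<tau>" if "\<kappa> \<in> period_box n" "\<tau> \<in> period_box n" for \<kappa> \<tau>
    using b that by (auto simp: bij_betw_def inj_on_def)
  define \<Phi> :: "(int^'d) \<times> 'r \<Rightarrow> (int^'d) \<times> 'r \<Rightarrow> 'k" where
    "\<Phi> = (\<lambda>(\<mu>, i) (\<kappa>, j). if i = j then lmonom (b \<kappa>) \<mu> else 0)"
  define \<Psi> :: "(int^'d) \<times> 'r \<Rightarrow> (int^'d) \<times> 'r \<Rightarrow> 'k" where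
    "\<Psi> = (\<lambda>(\<kappa>, i) (\<mu>, j). if i = j then lmonom (b \<kappa>) (- \<mu>) else 0)"
  define D :: "(int^'d) \<times> 'r \<Rightarrow> (int^'d) \<times> 'r \<Rightarrow> 'k" where
    "D = (\<lambda>(\<kappa>, i) (\<tau>, j). if \<kappa> = \<tau> then laurent_eval a (b \<kappa>) $ i $ j else 0)"
  define A :: "(int^'d) \<times> 'r \<Rightarrow> (int^'d) \<times> 'r \<Rightarrow> 'k" where
    "A = (\<lambda>p q. of_int (period_matrix a n p q))"

  \<comment> \<open>By orthogonality \<open>\<Psi>\<close> is inverse to \<open>\<Phi>\<close> up to
    the factor n^d, which is nonzero in characteristic 0.\<close>
  have "gdet ?I \<Psi> * gdet ?I \<Phi> = gdet ?I (\<lambda>p q. \<Sum>k\<in>?I. \<Psi> p k * \<Phi> k q)"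
    by (rule gdet_mult[OF fin, symmetric])
  also have "\<dots> = gdet ?I (\<lambda>p q. if p = q then of_nat n ^ CARD('d) else 0)"
  proof (rule gdet_cong)
    fix p q assume "p \<in> ?I" "q \<in> ?I"
    then obtain \<kappa> i \<tau> j where pq: "p = (\<kappa>, i)" "q = (\<tau>, j)" "\<kappa> \<in> period_box n" "\<tau> \<in> period_box n" by auto
    have "(\<Sum>k\<in>?I. \<Psi> p k * \<Phi> k q) =
       (\<Sum>\<mu>\<in>period_box n. \<Sum>i'\<in>UNIV. if i' = i then (if i = j then lmonom (b \<kappa>) (- \<mu>) * lmonom (b \<tau>) \<mu> else 0) else 0)"
      unfolding sum.cartesian_product' \<Psi>_def \<Phi>_def pq by (intro sum.cong refl) auto
    also have "\<dots> = (if i = j then \<Sum>\<mu>\<in>period_box n. lmonom (b \<kappa>) (- \<mu>) * lmonom (b \<tau>) \<mu> else 0)"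
      by simp
    also have "\<dots> = (if p = q then of_nat n ^ CARD('d) else 0)"
      using pq by (simp add: sum_lmonom_period_box[OF n bZ bZ] b_eq)
    finally show "(\<Sum>k\<in>?I. \<Psi> p k * \<Phi> k q) = (if p = q then of_nat n ^ CARD('d) else 0)" .
  qed
  also have "\<dots> \<noteq> 0" using n fin by (simp add: gdet_diagonal)
  finally have \<Phi>0: "gdet ?I \<Phi> \<noteq> 0" by auto

  \<comment> \<open>The intertwining relation A \<Phi> = \<Phi> D: a character turns the shift by
    \<open>\<nu>\<close> into multiplication by its value at \<open>\<nu>\<close>.\<close>
  have "gdet ?I A * gdet ?I \<Phi> = gdet ?I (\<lambda>p q. \<Sum>k\<in>?I. A p k * \<Phi> k q)"
    by (rule gdet_mult[OF fin, symmetric])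
  also have "\<dots> = gdet ?I (\<lambda>p q. \<Sum>k\<in>?I. \<Phi> p k * D k q)"
  proof (rule gdet_cong)
    fix p q assume "p \<in> ?I" "q \<in> ?I"
    then obtain l j \<kappa> i where pq: "p = (l, j)" "q = (\<kappa>, i)" "l \<in> period_box n" "\<kappa> \<in> period_box n" by auto
    have nz: "b \<kappa> $ k \<noteq> 0" for k
    proof
      assume "b \<kappa> $ k = 0"
      moreover have "(b \<kappa> $ k) ^ n = 1" using bZ[OF pq(4)] by (simp add: roots_of_unity_def)
      ultimately show False using n by (simp add: power_0_left)
    qed
    have "(\<Sum>k\<in>?I. A p k * \<Phi> k q) =
       (\<Sum>\<nu>\<in>{\<nu>. a \<nu> \<noteq> 0}. \<Sum>i'\<in>UNIV. of_int (a \<nu> $ j $ i') * \<Phi> (vmod (l + \<nu>) n, i') q)"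
      unfolding A_def pq(1)
      using period_matrix_sum[OF n, of a l j "\<lambda>k. \<Phi> k q"] vmod_id[OF pq(3)] by simp
    also have "\<dots> = (\<Sum>\<nu>\<in>{\<nu>. a \<nu> \<noteq> 0}. of_int (a \<nu> $ j $ i) * lmonom (b \<kappa>) (vmod (l + \<nu>) n))"
      by (simp add: \<Phi>_def pq(2) if_distrib cong: if_cong)
    also have "\<dots> = (\<Sum>\<nu>\<in>{\<nu>. a \<nu> \<noteq> 0}. of_int (a \<nu> $ j $ i) * (lmonom (b \<kappa>) l * lmonom (b \<kappa>) \<nu>))"
      by (simp add: lmonom_vmod[OF n bZ[OF pq(4)]] lmonom_add[OF nz])
    also have "\<dots> = lmonom (b \<kappa>) l * laurent_eval a (b \<kappa>) $ j $ i"
      by (simp add: laurent_eval_def lmonom_def sum_distrib_left mult.left_commute)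
    also have "\<dots> = (\<Sum>\<mu>\<in>period_box n. if \<mu> = \<kappa> then lmonom (b \<kappa>) l * laurent_eval a (b \<kappa>) $ j $ i else 0)"
      using pq(4) by (simp add: finite_period_box)
    also have "\<dots> = (\<Sum>\<mu>\<in>period_box n. \<Sum>i'\<in>UNIV. if i' = j then (if \<mu> = \<kappa> then lmonom (b \<kappa>) l * laurent_eval a (b \<kappa>) $ j $ i else 0) else 0)"
      by simp
    also have "\<dots> = (\<Sum>k\<in>?I. \<Phi> p k * D k q)"
      unfolding sum.cartesian_product' \<Phi>_def D_def pq by (intro sum.cong refl) auto
    finally show "(\<Sum>k\<in>?I. A p k * \<Phi> k q) = (\<Sum>k\<in>?I. \<Phi> p k * D k q)" .
  qed
  also have "\<dots> = gdet ?I D * gdet ?I \<Phi>"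
    by (subst gdet_mult[OF fin]) (rule mult.commute)
  finally have "gdet ?I A = gdet ?I D" using \<Phi>0 by simp
  also have "\<dots> = (\<Prod>\<kappa>\<in>period_box n. gdet UNIV (\<lambda>i j. laurent_eval a (b \<kappa>) $ i $ j))"
    unfolding D_def by (rule gdet_block_diagonal[OF finite_period_box]) simp
  also have "\<dots> = (\<Prod>\<kappa>\<in>period_box n. det (laurent_eval a (b \<kappa>)))"
    by (simp add: det_eq_gdet)
  also have "\<dots> = (\<Prod>\<zeta>\<in>?Z. det (laurent_eval a \<zeta>))"
    by (rule prod.reindex_bij_betw[OF b])
  finally show ?thesis by (simp add: A_def gdet_of_int)
qed

section \<open>The p-adic entropy as a Snirelman integral\<close>

theorem theorem3p2:
  fixes p :: nat
    and nv :: "'k::field_char_0 \<Rightarrow> real"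
    and lg :: "'k \<Rightarrow> 'k"
    and a :: "int^'d::finite \<Rightarrow> int^'r::finite^'r"
  assumes Cp: "is_Cp p nv"
    and log: "is_log_p p nv lg"
    and fin: "finite {\<nu>. a \<nu> \<noteq> 0}"
    and inv: "\<forall>z\<in>(torus_p nv :: ('k^'d) set). invertible (laurent_eval a z)"
  shows "(\<forall>n>0. coprime n p \<longrightarrow> finite (Fix_Gamma (Gamma_n n) (X_f a))) \<and>
         (\<exists>h. nv_limit_coprime p nv
                 (\<lambda>n. (1 / of_nat n ^ CARD('d)) *
                      lg (of_nat (card (Fix_Gamma (Gamma_n n) (X_f a))))) h
             \<and> snirelman_integral_is p nv (\<lambda>z::'k^'d. lg (det (laurent_eval a z))) h)"
proof -
  interpret iwasawa_log p nv lg
    using Cp log by unfold_locales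
  have nz: "det (laurent_eval a z) \<noteq> 0" if "z \<in> torus_p nv" for z :: "'k^'d"
    using inv that by (simp add: invertible_det_nz)
  obtain h where h: "snirelman_integral_is p nv (\<lambda>z::'k^'d. lg (det (laurent_eval a z))) h"
    using snirelman_lg_laurent[OF laurent_fun_det_laurent_eval nz] by blast
  have tors: "det (laurent_eval a \<zeta>) \<noteq> 0"
    if "n > 0" "\<forall>k. \<zeta> $ k \<in> roots_of_unity n" for n and \<zeta> :: "'k^'d"
    by (rule nz[OF torsion_in_torus[OF that]])
  have gdet_nz: "gdet (period_box n \<times> UNIV) (period_matrix a n) \<noteq> 0" if n: "n > 0" for n
  proof -
    \<comment> \<open>The integer is tested in \<open>'k\<close>, where it is a product of nonzero
      determinants; \<open>of_int\<close> is injective in characteristic 0.\<close>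
    have "of_int (gdet (period_box n \<times> UNIV) (period_matrix a n)) \<noteq> (0::'k)"
      unfolding gdet_period_matrix[OF n]
      using tors[OF n] by (subst prod_zero_iff[OF finite_vec_set[OF finite_roots_of_unity[OF n]]]) blast
    then show ?thesis by simp
  qed
  \<comment> \<open>The identity is exact for each \<open>n\<close>, so the entropy sequence
    inherits its limit from the Snirelman sums.\<close>
  have card: "lg (of_nat (card (Fix_Gamma (Gamma_n n) (X_f a)))) =
      (\<Sum>\<zeta>\<in>{\<zeta>::'k^'d. \<forall>i. \<zeta> $ i \<in> roots_of_unity n}. lg (det (laurent_eval a \<zeta>)))" if n: "n > 0" for n
    unfolding finite_card_Fix_Gamma(2)[OF n gdet_nz[OF n]] lg_of_nat_abs[OF gdet_nz[OF n]]
      gdet_period_matrix[OF n]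
    using tors[OF n] by (intro lg_prod) auto
  have "nv_limit_coprime p nv (\<lambda>n. (1 / of_nat n ^ CARD('d)) *
      lg (of_nat (card (Fix_Gamma (Gamma_n n) (X_f a))))) h"
    unfolding nv_limit_coprime_def
  proof (intro allI impI)
    fix e :: real assume "e > 0"
    then obtain N0 where N0: "\<And>N. N \<ge> N0 \<Longrightarrow> coprime N p \<Longrightarrow>
        nv ((1 / of_nat N ^ CARD('d)) *
          (\<Sum>\<zeta>\<in>{\<zeta>::'k^'d. \<forall>i. \<zeta> $ i \<in> roots_of_unity N}. lg (det (laurent_eval a \<zeta>))) - h) < e"
      using h unfolding snirelman_integral_is_def by blast
    show "\<exists>N. \<forall>n\<ge>N. coprime n p \<longrightarrow>
        nv ((1 / of_nat n ^ CARD('d)) * lg (of_nat (card (Fix_Gamma (Gamma_n n) (X_f a)))) - h) < e"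
    \<comment> \<open>Starting at \<open>Suc N0\<close> excludes \<open>n = 0\<close>, about which
      \<open>card\<close> says nothing.\<close>
    proof (intro exI[of _ "Suc N0"] allI impI)
      fix n assume "Suc N0 \<le> n" "coprime n p"
      then show "nv ((1 / of_nat n ^ CARD('d)) * lg (of_nat (card (Fix_Gamma (Gamma_n n) (X_f a)))) - h) < e"
        using N0[of n] by (simp only: card[of n])
    qed
  qed
  then show ?thesis using h finite_card_Fix_Gamma(1)[OF _ gdet_nz] by blast
qed

end
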